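(* Let $\mathcal{E}$ be a system of evolution equations $u_t=f(x,t,u,u_1,\dots,u_k)$, and let $\mathcal{N}_R$ and $\mathcal{N}_S$ be shadows of symmetries in the $\ell$-covering $\mathcal{L}\mathcal{E}$ corresponding to $\mathcal{C}$-differential operators $R,S\colon\varkappa\to\varkappa$. Then $$\{\mathcal{N}_R,\mathcal{N}_S\}=\mathcal{N}_{[R,S]_{FN}},$$ where $\{\cdot,\cdot\}$ is the Jacobi bracket on $\mathcal{L}\mathcal{E}$ and $[R,S]_{FN}$ is the Fr\"olicher--Nijenhuis bracket.
   Context: Setting: $u=(u^1,\dots,u^m)$, one space variable $x$. $\mathcal{E}$ has coordinates $x,t,u^j_k$ and total derivatives $D_x=\partial_x+\sum_{j,k}u^j_{k+1}\partial_{u^j_k}$, $D_t=\partial_t+\sum_{j,k}D_x^k(f^j)\partial_{u^j_k}$; $\mathcal{F}(\mathcal{E})$ is the algebra of smooth functions in $x,t$ and finitely many $u^j_k$. $\varkappa$ is, in coordinates, the module of $m$-tuples of functions from $\mathcal{F}(\mathcal{E})$. $\mathcal{C}$-differential operators are matrices with entries $\sum_i a_iD_x^i$, $a_i\in\mathcal{F}(\mathcal{E})$. $\mathcal{E}_\varphi=\sum_{j,k}D_x^k(\varphi^j)\partial_{u^j_k}$; $\{\varphi,\psi\}=\mathcal{E}_\varphi(\psi)-\mathcal{E}_\psi(\varphi)$ on $\varkappa$; $\ell_\psi(\varphi)=\mathcal{E}_\varphi(\psi)$; the linearization of the equation is $\ell_{\mathcal{E}}=D_t-\ell_f$. Fr\"olicher--Nijenhuis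 bracket: $[R,S]_{FN}(\varphi_1,\varphi_2)=\{R\varphi_1,S\varphi_2\}+\{S\varphi_1,R\varphi_2\}-R(\{S\varphi_1,\varphi_2\}+\{\varphi_1,S\varphi_2\}-S\{\varphi_1,\varphi_2\})-S(\{R\varphi_1,\varphi_2\}+\{\varphi_1,R\varphi_2\}-R\{\varphi_1,\varphi_2\})$, a skew-symmetric bilinear $\mathcal{C}$-differential operator $\varkappa\times\varkappa\to\varkappa$. $\ell$-covering $\mathcal{L}\mathcal{E}$: add odd (anticommuting) variables $q^j_k$, $1\le j\le m$, $k\ge 0$ ($q^j=q^j_0$), subject to $q_t=\ell_f(q)$; total derivatives $\tilde D_x=D_x+\sum q^j_{k+1}\partial_{q^j_k}$, $\tilde D_t=D_t+\sum\tilde D_x^k(\tilde\ell_f(q)^j)\partial_{q^j_k}$. A tilde over a $\mathcal{C}$-differential operator means that $D_x,D_t$ are replaced by $\tilde D_x,\tilde D_t$. Functions on $\mathcal{L}\mathcal{E}$ are polynomials in the $q^j_k$ over $\mathcal{F}(\mathcal{E})$. For $R=\|\sum_i a^l_{ij}D_x^i\|$ put $\mathcal{N}_R^l=\sum_{i,j}a^l_{ij}q^j_i$. $\mathcal{N}_R$ is a shadow of symmetry if $\tilde\ell_{\mathcal{E}}(\mathcal{N}_R)=0$. For an $m$-vector function $\mathcal{N}$ on $\mathcal{L}\mathcal{E}$: $\tilde\ell_{\mathcal{N}}(\chi)^l=\sum\frac{\partial\mathcal{N}^l}{\partial u^j_k}\tilde D_x^k(\chi^j)$ (factors in the order written). Put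 $\beta_R^j=\sum_{k,l}\frac{\partial\mathcal{N}_R^j}{\partial u^l_k}q^l_k$ and let $Q_R=\sum_{k,j}\tilde D_x^k(\mathcal{N}_R^j)\partial_{u^j_k}+\sum_{k,j}\tilde D_x^k(\beta_R^j)\partial_{q^j_k}$ (an odd derivation). The Jacobi bracket is $\{\mathcal{N}_R,\mathcal{N}_S\}=Q_R(\mathcal{N}_S)+Q_S(\mathcal{N}_R)$; explicitly $$\{\mathcal{N}_R,\mathcal{N}_S\}=-\tilde\ell_{\mathcal{N}_R}(\mathcal{N}_S)-\tilde\ell_{\mathcal{N}_S}(\mathcal{N}_R)+R(\tilde\ell_{\mathcal{N}_S}(q))+S(\tilde\ell_{\mathcal{N}_R}(q)),$$ with $R,S$ lifted to $\mathcal{L}\mathcal{E}$. Correspondence for bilinear operators: skew-symmetric bilinear $\mathcal{C}$-differential operators $\Delta\colon\varkappa\times\varkappa\to\varkappa$ correspond bijectively to vector functions $\mathcal{N}_\Delta$ quadratic in the odd variables $q$, the monomial $c\,q^a_iq^b_j$ corresponding to $(\varphi_1,\varphi_2)\mapsto c\,\bigl(D_x^i(\varphi_1^a)D_x^j(\varphi_2^b)-D_x^j(\varphi_1^b)D_x^i(\varphi_2^a)\bigr)$; equivalently, if $\Delta(\varphi_1,\varphi_2)=\sum c^{ij}_{ab}D_x^i(\varphi_1^a)D_x^j(\varphi_2^b)$ is skew-symmetric, then $\mathcal{N}_\Delta=\tfrac12\sum c^{ij}_{ab}q^a_iq^b_j$. *)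

theory Defs
  imports "HOL-Analysis.Analysis" "HOL-Library.Groups_Big_Fun"
begin

text \<open>
  The dependent variables are indexed by a finite type \<open>'m\<close>.  Its linear order has no
  mathematical meaning: it only fixes a normal form for monomials in the odd variables.
  \<open>CU j k\<close> is the coordinate \<open>u\<^sup>j\<^sub>k\<close>.
\<close>

datatype 'm coord = CX | CT | CU 'm nat

type_synonym 'm jet = "'m coord \<Rightarrow> real"
type_synonym 'm func = "'m jet \<Rightarrow> real"

definition pd :: "'m coord \<Rightarrow> 'm func \<Rightarrow> 'm func" where
  "pd c g = (\<lambda>p. deriv (\<lambda>s. g (p(c := s))) (p c))"

text \<open>
  Continuity refers to the product topology on \<^typ>\<open>'m jet\<close>.  For a function of finitely many
  coordinates this is ordinary continuity in these coordinates, so that \<open>cont_diff n\<close> is then the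
  usual class of \<open>n\<close> times continuously differentiable functions.
\<close>

primrec cont_diff :: "nat \<Rightarrow> 'm func \<Rightarrow> bool" where
  "cont_diff 0 g \<longleftrightarrow> continuous_on UNIV g"
| "cont_diff (Suc n) g \<longleftrightarrow> continuous_on UNIV g \<and>
     (\<forall>c. (\<forall>p. (\<lambda>s. g (p(c := s))) field_differentiable at (p c)) \<and> cont_diff n (pd c g))"

definition depends_only_on :: "'m coord set \<Rightarrow> 'm func \<Rightarrow> bool" where
  "depends_only_on C g \<longleftrightarrow> (\<forall>p p'. (\<forall>c\<in>C. p c = p' c) \<longrightarrow> g p = g p')"

definition FE :: "'m func set" where
  "FE = {g. (\<forall>n. cont_diff n g) \<and> (\<exists>C. finite C \<and> depends_only_on C g)}"

definition kappa :: "('m \<Rightarrow> 'm func) set" where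
  "kappa = {\<phi>. \<forall>j. \<phi> j \<in> FE}"

text \<open>
  \<^const>\<open>Sum_any\<close> is the sum over the support of its argument.  It is only used for
  sums which have finitely many nonzero terms at each point.
\<close>

definition Dx :: "'m func \<Rightarrow> 'm func" where
  "Dx g = (\<lambda>p. pd CX g p + Sum_any (\<lambda>(j, k). p (CU j (Suc k)) * pd (CU j k) g p))"

definition Ev :: "('m \<Rightarrow> 'm func) \<Rightarrow> 'm func \<Rightarrow> 'm func" where
  "Ev \<phi> g = (\<lambda>p. Sum_any (\<lambda>(j, k). (Dx ^^ k) (\<phi> j) p * pd (CU j k) g p))"

definition Dt :: "('m \<Rightarrow> 'm func) \<Rightarrow> 'm func \<Rightarrow> 'm func" where
  "Dt f g = (\<lambda>p. pd CT g p + Ev f g p)"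

definition jacobi :: "('m \<Rightarrow> 'm func) \<Rightarrow> ('m \<Rightarrow> 'm func) \<Rightarrow> 'm \<Rightarrow> 'm func" where
  "jacobi \<phi> \<psi> = (\<lambda>l p. Ev \<phi> (\<psi> l) p - Ev \<psi> (\<phi> l) p)"

text \<open>\<open>R l j i\<close> is the coefficient of \<open>D\<^sub>x\<^sup>i\<close> in the entry of the matrix \<open>R\<close> in row \<open>l\<close>, column \<open>j\<close>.\<close>

type_synonym 'm cdo = "'m \<Rightarrow> 'm \<Rightarrow> nat \<Rightarrow> 'm func"

definition cdo :: "'m cdo set" where
  "cdo = {R. (\<forall>l j i. R l j i \<in> FE) \<and> (\<forall>l j. finite {i. R l j i \<noteq> (\<lambda>p. 0)})}"

definition cdo_apply :: "'m cdo \<Rightarrow> ('m \<Rightarrow> 'm func) \<Rightarrow> 'm \<Rightarrow> 'm func" where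
  "cdo_apply R \<phi> = (\<lambda>l p. Sum_any (\<lambda>(j, i). R l j i p * (Dx ^^ i) (\<phi> j) p))"

definition fn_bracket ::
  "(('m \<Rightarrow> 'm func) \<Rightarrow> 'm \<Rightarrow> 'm func) \<Rightarrow> (('m \<Rightarrow> 'm func) \<Rightarrow> 'm \<Rightarrow> 'm func) \<Rightarrow>
   ('m \<Rightarrow> 'm func) \<Rightarrow> ('m \<Rightarrow> 'm func) \<Rightarrow> 'm \<Rightarrow> 'm func" where
  "fn_bracket R S \<phi> \<psi> = (\<lambda>l p.
     jacobi (R \<phi>) (S \<psi>) l p + jacobi (S \<phi>) (R \<psi>) l p
     - R (\<lambda>l p. jacobi (S \<phi>) \<psi> l p + jacobi \<phi> (S \<psi>) l p - S (jacobi \<phi> \<psi>) l p) l p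
     - S (\<lambda>l p. jacobi (R \<phi>) \<psi> l p + jacobi \<phi> (R \<psi>) l p - R (jacobi \<phi> \<psi>) l p) l p)"

text \<open>\<open>c l (a, i) (b, j)\<close> is the coefficient of \<open>D\<^sub>x\<^sup>i(\<phi>\<^sup>a) D\<^sub>x\<^sup>j(\<psi>\<^sup>b)\<close> in the \<open>l\<close>-th component.\<close>

type_synonym 'm bicdo = "'m \<Rightarrow> 'm \<times> nat \<Rightarrow> 'm \<times> nat \<Rightarrow> 'm func"

definition bicdo :: "'m bicdo set" where
  "bicdo = {c. (\<forall>l g h. c l g h \<in> FE) \<and> (\<forall>l. finite {(g, h). c l g h \<noteq> (\<lambda>p. 0)})}"

definition bicdo_apply :: "'m bicdo \<Rightarrow> ('m \<Rightarrow> 'm func) \<Rightarrow> ('m \<Rightarrow> 'm func) \<Rightarrow> 'm \<Rightarrow> 'm func" where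
  "bicdo_apply c \<phi> \<psi> = (\<lambda>l p. Sum_any (\<lambda>((a, i), (b, j)).
     c l (a, i) (b, j) p * (Dx ^^ i) (\<phi> a) p * (Dx ^^ j) (\<psi> b) p))"

definition represents ::
  "'m bicdo \<Rightarrow> (('m \<Rightarrow> 'm func) \<Rightarrow> ('m \<Rightarrow> 'm func) \<Rightarrow> 'm \<Rightarrow> 'm func) \<Rightarrow> bool" where
  "represents c \<Delta> \<longleftrightarrow> c \<in> bicdo \<and> (\<forall>\<phi>\<in>kappa. \<forall>\<psi>\<in>kappa. \<Delta> \<phi> \<psi> = bicdo_apply c \<phi> \<psi>)"

text \<open>
  The odd variable \<open>q\<^sup>j\<^sub>k\<close> is the generator \<open>(j, k)\<close>.  A function \<open>N\<close> on the covering is given by its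
  coefficients: \<open>N A\<close>, for a finite set \<open>A\<close> of generators, is the coefficient of the product of the
  elements of \<open>A\<close> in increasing lexicographic order.  \<open>ksign B C\<close> is the sign of the permutation
  which sorts the concatenation of the products over \<open>B\<close> and over \<open>C\<close>.
\<close>

type_synonym 'm lfunc = "('m \<times> nat) set \<Rightarrow> 'm func"

definition gen_less :: "'m::linorder \<times> nat \<Rightarrow> 'm \<times> nat \<Rightarrow> bool" where
  "gen_less g h \<longleftrightarrow> fst g < fst h \<or> fst g = fst h \<and> snd g < snd h"

definition ksign :: "('m::linorder \<times> nat) set \<Rightarrow> ('m \<times> nat) set \<Rightarrow> real" where
  "ksign B C = (-1) ^ card {(b, c). b \<in> B \<and> c \<in> C \<and> gen_less c b}"

definition gmult :: "'m::linorder lfunc \<Rightarrow> 'm lfunc \<Rightarrow> 'm lfunc" (infixl "\<star>" 70) where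
  "N \<star> M = (\<lambda>A p. \<Sum>B\<in>Pow A. ksign B (A - B) * N B p * M (A - B) p)"

definition embed :: "'m func \<Rightarrow> 'm lfunc" where
  "embed g = (\<lambda>A p. if A = {} then g p else 0)"

definition qvar :: "'m \<times> nat \<Rightarrow> 'm lfunc" where
  "qvar g = (\<lambda>A p. if A = {g} then 1 else 0)"

definition pd_even :: "'m coord \<Rightarrow> 'm lfunc \<Rightarrow> 'm lfunc" where
  "pd_even c N = (\<lambda>A. pd c (N A))"

text \<open>Odd derivatives act from the left: \<open>g\<close> is moved to the front of the monomial and removed.\<close>

definition pd_odd :: "'m::linorder \<times> nat \<Rightarrow> 'm lfunc \<Rightarrow> 'm lfunc" where
  "pd_odd g N = (\<lambda>A p. if g \<in> A then 0 else ksign {g} A * N (insert g A) p)"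

definition Dx_cov :: "'m::linorder lfunc \<Rightarrow> 'm lfunc" where
  "Dx_cov N = (\<lambda>A p. Dx (N A) p + Sum_any (\<lambda>(j, k). (qvar (j, Suc k) \<star> pd_odd (j, k) N) A p))"

text \<open>\<open>ell_cov N \<xi>\<close> is the lifted linearization of the vector function \<open>N\<close> applied to \<open>\<xi>\<close>.\<close>

definition ell_cov :: "('m::linorder \<Rightarrow> 'm lfunc) \<Rightarrow> ('m \<Rightarrow> 'm lfunc) \<Rightarrow> 'm \<Rightarrow> 'm lfunc" where
  "ell_cov N \<xi> = (\<lambda>l A p. Sum_any (\<lambda>(j, k). (pd_even (CU j k) (N l) \<star> (Dx_cov ^^ k) (\<xi> j)) A p))"

definition Dt_cov :: "('m::linorder \<Rightarrow> 'm func) \<Rightarrow> 'm lfunc \<Rightarrow> 'm lfunc" where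
  "Dt_cov f N = (\<lambda>A p. Dt f (N A) p + Sum_any (\<lambda>(j, k).
     ((Dx_cov ^^ k) (ell_cov (\<lambda>l. embed (f l)) (\<lambda>l. qvar (l, 0)) j) \<star> pd_odd (j, k) N) A p))"

definition odd_vector :: "'m cdo \<Rightarrow> 'm \<Rightarrow> 'm lfunc" where
  "odd_vector R = (\<lambda>l A p. Sum_any (\<lambda>(j, i). R l j i p * qvar (j, i) A p))"

definition is_shadow :: "('m::linorder \<Rightarrow> 'm func) \<Rightarrow> ('m \<Rightarrow> 'm lfunc) \<Rightarrow> bool" where
  "is_shadow f N \<longleftrightarrow>
     (\<forall>l A p. Dt_cov f (N l) A p - ell_cov (\<lambda>l. embed (f l)) N l A p = 0)"

definition beta_cov :: "('m::linorder \<Rightarrow> 'm lfunc) \<Rightarrow> 'm \<Rightarrow> 'm lfunc" where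
  "beta_cov N = (\<lambda>j A p. Sum_any (\<lambda>(l, k). (pd_even (CU l k) (N j) \<star> qvar (l, k)) A p))"

definition Q_cov :: "('m::linorder \<Rightarrow> 'm lfunc) \<Rightarrow> 'm lfunc \<Rightarrow> 'm lfunc" where
  "Q_cov N G = (\<lambda>A p.
     Sum_any (\<lambda>(j, k). ((Dx_cov ^^ k) (N j) \<star> pd_even (CU j k) G) A p) +
     Sum_any (\<lambda>(j, k). ((Dx_cov ^^ k) (beta_cov N j) \<star> pd_odd (j, k) G) A p))"

definition jacobi_cov ::
  "('m::linorder \<Rightarrow> 'm lfunc) \<Rightarrow> ('m \<Rightarrow> 'm lfunc) \<Rightarrow> 'm \<Rightarrow> 'm lfunc" where
  "jacobi_cov N M = (\<lambda>l A p. Q_cov N (M l) A p + Q_cov M (N l) A p)"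

text \<open>
  The quadratic vector function of a skew-symmetric bilinear \<open>\<C>\<close>-differential operator.  The
  coefficients of such an operator are unique by \<open>represents_unique\<close> below.
\<close>

definition quadratic_vector ::
  "(('m::linorder \<Rightarrow> 'm func) \<Rightarrow> ('m \<Rightarrow> 'm func) \<Rightarrow> 'm \<Rightarrow> 'm func) \<Rightarrow> 'm \<Rightarrow> 'm lfunc" where
  "quadratic_vector \<Delta> = (let c = (THE c. represents c \<Delta>) in
     (\<lambda>l A p. 1 / 2 * Sum_any (\<lambda>(g, h). c l g h p * (qvar g \<star> qvar h) A p)))"

definition xpow :: "real \<Rightarrow> nat \<Rightarrow> 'm func" where
  "xpow x i = (\<lambda>p. (p CX - x) ^ i / fact i)"

lemma has_deriv_xpow:
  "((\<lambda>s. (s - x) ^ i / fact i :: real) has_field_derivative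
     (if i = 0 then 0 else (s - x) ^ (i - 1) / fact (i - 1))) (at s)"
proof (cases i)
  case (Suc k)
  have "((\<lambda>s. (s - x) ^ Suc k / fact (Suc k) :: real) has_field_derivative
     (real (Suc k) * (s - x) ^ k / fact (Suc k))) (at s)"
    by (auto intro!: derivative_eq_intros simp del: power_Suc)
  moreover have "real (Suc k) * (s - x) ^ k / fact (Suc k) = (s - x) ^ k / fact k"
    by (simp add: fact_Suc del: of_nat_Suc)
  ultimately show ?thesis using Suc by simp
qed auto

lemma pd_xpow:
  "pd c (xpow x i) = (if c = CX \<and> i > 0 then xpow x (i - 1) else (\<lambda>p. 0))"
  using has_deriv_xpow[of x i, THEN DERIV_imp_deriv]
  by (cases c) (auto simp: pd_def xpow_def fun_eq_iff)

lemma pd_zero: "pd c (\<lambda>p. 0) = (\<lambda>p. 0)"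
  by (simp add: pd_def)

lemma cont_diff_zero: "cont_diff n (\<lambda>p. 0)"
  by (induction n) (auto simp: pd_zero)

lemma zero_in_FE: "(\<lambda>p. 0) \<in> FE"
  by (auto simp: FE_def cont_diff_zero depends_only_on_def intro: exI[of _ "{}"])

lemma continuous_xpow: "continuous_on UNIV (xpow x i)"
  unfolding xpow_def by (intro continuous_intros) auto

lemma cont_diff_xpow: "cont_diff n (xpow x i)"
proof (induction n arbitrary: i)
  case (Suc n)
  have "(\<lambda>s. xpow x i (p(c := s))) field_differentiable at (p c)" for p c
    using has_deriv_xpow[of x i] by (cases "c = CX") (auto simp: xpow_def field_differentiable_def)
  then have "\<forall>p. (\<lambda>s. xpow x i (p(c := s))) field_differentiable at (p c)" for c by blast
  then show ?case using Suc by (auto simp: continuous_xpow pd_xpow cont_diff_zero)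
qed (simp add: continuous_xpow)

lemma xpow_in_FE: "xpow x i \<in> FE"
proof -
  have "depends_only_on {CX} (xpow x i)"
    by (simp add: depends_only_on_def xpow_def)
  then show ?thesis
    unfolding FE_def by (blast intro: cont_diff_xpow)
qed

lemma Dx_zero: "Dx (\<lambda>p. 0) = (\<lambda>p. 0)"
  by (simp add: Dx_def pd_zero case_prod_unfold)

lemma Dx_xpow: "Dx (xpow x i) = (if i > 0 then xpow x (i - 1) else (\<lambda>p. 0))"
  by (auto simp: Dx_def pd_xpow case_prod_unfold)

lemma Dx_pow_zero: "(Dx ^^ k) (\<lambda>p. 0) = (\<lambda>p. 0)"
  by (induction k) (simp_all add: Dx_zero)

lemma Dx_pow_xpow: "(Dx ^^ k) (xpow x i) = (if k \<le> i then xpow x (i - k) else (\<lambda>p. 0))"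
  by (induction k) (auto simp: Dx_zero Dx_xpow not_less_eq_eq)

lemma Dx_pow_xpow_at: "(Dx ^^ k) (xpow (p CX) i) p = (if k = i then 1 else 0)"
  unfolding Dx_pow_xpow by (auto simp: xpow_def)

lemma bicdo_apply_xpow:
  "bicdo_apply c (\<lambda>j. if j = a then xpow (p CX) i else (\<lambda>p. 0))
     (\<lambda>j. if j = b then xpow (p CX) k else (\<lambda>p. 0)) l p = c l (a, i) (b, k) p"
proof -
  have 1: "(Dx ^^ n) (if j = a' then xpow (p CX) m else (\<lambda>p. 0)) p
      = (if (j, n) = (a', m) then 1 else 0)" for n j m and a' :: 'a
    by (auto simp: Dx_pow_zero Dx_pow_xpow_at)
  have "bicdo_apply c (\<lambda>j. if j = a then xpow (p CX) i else (\<lambda>p. 0))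
     (\<lambda>j. if j = b then xpow (p CX) k else (\<lambda>p. 0)) l p
     = Sum_any (\<lambda>z. if z = ((a, i), (b, k)) then c l (a, i) (b, k) p else 0)"
    unfolding bicdo_apply_def 1 by (intro Sum_any.cong) (auto split: if_splits)
  also have "\<dots> = c l (a, i) (b, k) p"
    by simp
  finally show ?thesis .
qed

lemma represents_unique:
  fixes c d :: "'m bicdo"
  assumes "represents c \<Delta>" "represents d \<Delta>"
  shows "c = d"
proof (intro ext)
  fix l :: 'm and g h :: "'m \<times> nat" and p :: "'m jet"
  obtain a i b k where gh: "g = (a, i)" "h = (b, k)" by fastforce
  define \<phi> :: "'m \<Rightarrow> 'm func" where "\<phi> = (\<lambda>j. if j = a then xpow (p CX) i else (\<lambda>p. 0))"
  define \<psi> :: "'m \<Rightarrow> 'm func" where "\<psi> = (\<lambda>j. if j = b then xpow (p CX) k else (\<lambda>p. 0))"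
  have "\<phi> \<in> kappa" "\<psi> \<in> kappa"
    by (auto simp: \<phi>_def \<psi>_def kappa_def xpow_in_FE zero_in_FE)
  then have "bicdo_apply c \<phi> \<psi> = bicdo_apply d \<phi> \<psi>"
    using assms unfolding represents_def by metis
  then show "c l g h p = d l g h p"
    using bicdo_apply_xpow[of c a p i b k l] bicdo_apply_xpow[of d a p i b k l]
    by (simp add: gh \<phi>_def \<psi>_def)
qed

end

theory Submission
  imports Defs
begin

text \<open>
  For a \<open>\<C>\<close>-differential operator \<open>R\<close> let \<open>R\<^bsub>\<theta>\<^esub>\<close> be the operator whose coefficients are
  \<open>\<E>\<^bsub>\<theta>\<^esub>\<close> applied to those of \<open>R\<close>, so that \<open>\<E>\<^bsub>\<theta>\<^esub>(R\<phi>) = R\<^bsub>\<theta>\<^esub>(\<phi>) + R(\<E>\<^bsub>\<theta>\<^esub>\<phi>)\<close> because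
  \<open>\<E>\<^bsub>\<theta>\<^esub>\<close> commutes with \<open>D\<^sub>x\<close>.  All terms \<open>\<E>\<^bsub>\<theta>\<^esub>\<phi>\<close> cancel in the Froelicher-Nijenhuis bracket, which
  becomes \<open>A(\<phi>, \<psi>) - A(\<psi>, \<phi>)\<close> with
  \<open>A(\<phi>, \<psi>) = S\<^bsub>R\<phi>\<^esub>(\<psi>) + R\<^bsub>S\<phi>\<^esub>(\<psi>) - R(S\<^bsub>\<phi>\<^esub>(\<psi>)) - S(R\<^bsub>\<phi>\<^esub>(\<psi>))\<close>.  Replacing the first argument of
  a bilinear operator by the left and the second by the right factor \<open>q\<close> intertwines \<open>D\<^sub>x\<close> with its
  lift to the covering, and it sends the four terms of \<open>A\<close> to the four terms of
  \<open>Q\<^sub>R(\<N>\<^sub>S) + Q\<^sub>S(\<N>\<^sub>R)\<close>; the minus signs come from moving \<open>q\<^sup>l\<^sub>k\<close> to the front in \<open>\<beta>\<^sub>R\<close>.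
\<close>

section \<open>Smooth functions on the jet space\<close>

text \<open>Mean value theorem twice: first in \<open>s\<close> for the difference
  \<open>h s (b + e) - h s b\<close>, then in \<open>t\<close> for \<open>h1 x\<close>. Only one
  order of differentiation enters.\<close>

lemma second_difference_eq_mixed_derivative:
  fixes h h1 h12 :: "real \<Rightarrow> real \<Rightarrow> real"
  assumes "\<And>s t. ((\<lambda>s. h s t) has_field_derivative h1 s t) (at s)"
    and "\<And>s t. ((\<lambda>t. h1 s t) has_field_derivative h12 s t) (at t)"
    and "e > 0"
  obtains x y where "a < x" "x < a + e" "b < y" "y < b + e"
    "h (a + e) (b + e) - h (a + e) b - (h a (b + e) - h a b) = e * (e * h12 x y)"
proof -
  have "((\<lambda>s. h s (b + e) - h s b) has_field_derivative h1 s (b + e) - h1 s b) (at s)" for s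
    by (intro DERIV_diff assms)
  then obtain x where x: "a < x" "x < a + e"
    "h (a + e) (b + e) - h (a + e) b - (h a (b + e) - h a b) = e * (h1 x (b + e) - h1 x b)"
    using MVT2[of a "a + e" "\<lambda>s. h s (b + e) - h s b" "\<lambda>s. h1 s (b + e) - h1 s b"] assms(3)
    by auto
  obtain y where "b < y" "y < b + e" "h1 x (b + e) - h1 x b = e * h12 x y"
    using MVT2[of b "b + e" "h1 x" "h12 x"] assms(2,3) by auto
  with x that show thesis by simp
qed

text \<open>Schwarz's theorem. The second difference over a square is symmetric in the two
  variables, so on each square some value of \<open>h12\<close> equals some value of
  \<open>h21\<close>; shrinking the squares to \<open>(a, b)\<close> and using continuity gives
  equality at that point.\<close>

lemma mixed_derivatives_eq:
  fixes h h1 h2 h12 h21 :: "real \<Rightarrow> real \<Rightarrow> real"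
  assumes h1: "\<And>s t. ((\<lambda>s. h s t) has_field_derivative h1 s t) (at s)"
    and h2: "\<And>s t. ((\<lambda>t. h s t) has_field_derivative h2 s t) (at t)"
    and h12: "\<And>s t. ((\<lambda>t. h1 s t) has_field_derivative h12 s t) (at t)"
    and h21: "\<And>s t. ((\<lambda>s. h2 s t) has_field_derivative h21 s t) (at s)"
    and cont12: "continuous_on UNIV (\<lambda>(s, t). h12 s t)"
    and cont21: "continuous_on UNIV (\<lambda>(s, t). h21 s t)"
  shows "h12 a b = h21 a b"
proof -
  define e where "e n = inverse (real (Suc n))" for n
  have e: "e n > 0" for n by (simp add: e_def)
  have "\<exists>x y x' y'. a < x \<and> x < a + e n \<and> b < y \<and> y < b + e n
      \<and> a < x' \<and> x' < a + e n \<and> b < y' \<and> y' < b + e n \<and> h12 x y = h21 x' y'" for n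
  proof -
    obtain x y where xy: "a < x" "x < a + e n" "b < y" "y < b + e n"
      "h (a + e n) (b + e n) - h (a + e n) b - (h a (b + e n) - h a b) = e n * (e n * h12 x y)"
      using second_difference_eq_mixed_derivative[OF h1 h12 e] .
    \<comment> \<open>The same second difference for the transposed function: its four terms are
      only grouped differently.\<close>
    obtain y' x' where xy': "b < y'" "y' < b + e n" "a < x'" "x' < a + e n"
      "h (a + e n) (b + e n) - h a (b + e n) - (h (a + e n) b - h a b) = e n * (e n * h21 x' y')"
      using second_difference_eq_mixed_derivative[of "\<lambda>t s. h s t" "\<lambda>t s. h2 s t"
          "\<lambda>t s. h21 s t" "e n" b a, OF h2 h21 e] by blast
    have "e n * (e n * h12 x y) = e n * (e n * h21 x' y')"
      using xy(5) xy'(5) by linarith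
    then have "h12 x y = h21 x' y'" using e[of n] by simp
    with xy xy' show ?thesis by blast
  qed
  then obtain x y x' y' where *: "\<And>n. a < x n \<and> x n < a + e n \<and> b < y n \<and> y n < b + e n
      \<and> a < x' n \<and> x' n < a + e n \<and> b < y' n \<and> y' n < b + e n \<and> h12 (x n) (y n) = h21 (x' n) (y' n)"
    by metis
  have squeeze: "z \<longlonglongrightarrow> c" if "\<And>n. c < z n \<and> z n < c + e n" for z :: "nat \<Rightarrow> real" and c
  proof (rule tendsto_sandwich[of "\<lambda>_. c" z _ "\<lambda>n. c + e n"])
    show "(\<lambda>n. c + e n) \<longlonglongrightarrow> c"
      unfolding e_def using tendsto_add[OF tendsto_const LIMSEQ_inverse_real_of_nat, of c] by simp
    show "eventually (\<lambda>n. c \<le> z n) sequentially" "eventually (\<lambda>n. z n \<le> c + e n) sequentially"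
      using that by (auto intro!: always_eventually less_imp_le)
  qed auto
  have lim: "(\<lambda>n. (x n, y n)) \<longlonglongrightarrow> (a, b)" "(\<lambda>n. (x' n, y' n)) \<longlonglongrightarrow> (a, b)"
    using * by (auto intro!: tendsto_Pair squeeze)
  have "(\<lambda>n. h12 (x n) (y n)) \<longlonglongrightarrow> h12 a b"
    using continuous_on_tendsto_compose[OF cont12 lim(1)] by simp
  moreover have "(\<lambda>n. h21 (x' n) (y' n)) \<longlonglongrightarrow> h21 a b"
    using continuous_on_tendsto_compose[OF cont21 lim(2)] by simp
  ultimately show ?thesis
    using * LIMSEQ_unique by simp
qed

section \<open>Closure properties of the classes \<open>cont_diff n\<close>\<close>

lemma cont_diff_continuous: "cont_diff n g \<Longrightarrow> continuous_on UNIV g"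
  by (cases n) auto

lemma cont_diff_Suc: "cont_diff (Suc n) g \<Longrightarrow> cont_diff n g"
proof (induction n arbitrary: g)
  case (Suc n)
  then have "cont_diff n (pd c g)" for c
    using cont_diff.simps(2)[of "Suc n" g] by blast
  with Suc.prems show ?case
    unfolding cont_diff.simps(2)[of n g] cont_diff.simps(2)[of "Suc n" g] by blast
qed simp

text \<open>Changing the base point to \<open>p(c := s)\<close> leaves the line in direction
  \<open>c\<close> unchanged, which yields the derivative along the whole line and not only at
  \<open>p c\<close>.\<close>

lemma has_pd:
  assumes "cont_diff (Suc n) g"
  shows "((\<lambda>s. g (p(c := s))) has_field_derivative pd c g (p(c := s))) (at s)"
proof -
  have "(\<lambda>u. g ((p(c := s))(c := u))) field_differentiable at ((p(c := s)) c)"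
    using assms unfolding cont_diff.simps by blast
  then show ?thesis
    by (simp add: pd_def DERIV_deriv_iff_field_differentiable)
qed

lemma pd_eqI:
  assumes "((\<lambda>s. g (p(c := s))) has_field_derivative d) (at (p c))"
  shows "pd c g p = d"
  using assms DERIV_imp_deriv by (force simp: pd_def)

text \<open>Derivatives are unique, so an explicit candidate \<open>d\<close> is the family of
  partial derivatives and regularity can be checked on its formula.\<close>

lemma cont_diff_SucI:
  assumes "continuous_on UNIV g"
    and "\<And>c p. ((\<lambda>s. g (p(c := s))) has_field_derivative d c p) (at (p c))"
    and "\<And>c. cont_diff n (d c)"
  shows "cont_diff (Suc n) g"
proof -
  have "pd c g = d c" for c
    using assms(2) by (auto intro!: pd_eqI ext)
  with assms show ?thesis
    by (auto simp: field_differentiable_def)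
qed

lemma has_pd_at:
  assumes "cont_diff (Suc n) g"
  shows "((\<lambda>s. g (p(c := s))) has_field_derivative pd c g p) (at (p c))"
  using has_pd[OF assms, of p c "p c"] by simp

lemma cont_diff_pd: "cont_diff (Suc n) g \<Longrightarrow> cont_diff n (pd c g)"
  by simp

lemma cont_diff_const: "cont_diff n (\<lambda>p. a)"
proof (cases n)
  case (Suc k)
  show ?thesis unfolding Suc
    by (rule cont_diff_SucI[where d = "\<lambda>c p. 0"]) (auto simp: cont_diff_zero)
qed simp

lemma cont_diff_coord: "cont_diff n (\<lambda>p. p c)"
proof (cases n)
  case (Suc k)
  show ?thesis unfolding Suc
  proof (rule cont_diff_SucI[where d = "\<lambda>d p. if d = c then 1 else 0"])
    fix d and p :: "'a jet"
    show "((\<lambda>s. (p(d := s)) c) has_field_derivative (if d = c then 1 else 0)) (at (p d))"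
      by (cases "d = c") auto
  qed (auto simp: cont_diff_const intro: continuous_on_product_coordinates)
qed (auto intro: continuous_on_product_coordinates)

lemma cont_diff_add:
  "cont_diff n g \<Longrightarrow> cont_diff n h \<Longrightarrow> cont_diff n (\<lambda>p. g p + h p)"
proof (induction n arbitrary: g h)
  case (Suc n)
  show ?case
  proof (rule cont_diff_SucI[where d = "\<lambda>c p. pd c g p + pd c h p"])
    show "((\<lambda>s. g (p(c := s)) + h (p(c := s))) has_field_derivative pd c g p + pd c h p) (at (p c))"
      for c p
      by (intro DERIV_add has_pd_at[OF Suc.prems(1)] has_pd_at[OF Suc.prems(2)])
    show "cont_diff n (\<lambda>p. pd c g p + pd c h p)" for c
      using Suc.prems by (intro Suc.IH cont_diff_pd)
  qed (use Suc.prems in \<open>auto intro!: continuous_intros\<close>)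
qed (auto intro: continuous_intros)

lemma cont_diff_mult:
  "cont_diff n g \<Longrightarrow> cont_diff n h \<Longrightarrow> cont_diff n (\<lambda>p. g p * h p)"
proof (induction n arbitrary: g h)
  case (Suc n)
  show ?case
  proof (rule cont_diff_SucI[where d = "\<lambda>c p. pd c g p * h p + pd c h p * g p"])
    show "((\<lambda>s. g (p(c := s)) * h (p(c := s))) has_field_derivative
        pd c g p * h p + pd c h p * g p) (at (p c))" for c p
      by (rule DERIV_cong[OF DERIV_mult[OF has_pd_at[OF Suc.prems(1)] has_pd_at[OF Suc.prems(2)]]])
        simp
    \<comment> \<open>The product rule leaves undifferentiated factors; their regularity is lowered
      from \<open>Suc n\<close> to \<open>n\<close> so that the induction hypothesis
      applies.\<close>
    show "cont_diff n (\<lambda>p. pd c g p * h p + pd c h p * g p)" for c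
      using Suc.prems Suc.prems[THEN cont_diff_Suc] by (intro cont_diff_add Suc.IH cont_diff_pd)
  qed (use Suc.prems in \<open>auto intro!: continuous_intros\<close>)
qed (auto intro: continuous_intros)

section \<open>The algebra \<open>FE\<close> and its partial derivatives\<close>

lemma FE_cont_diff: "g \<in> FE \<Longrightarrow> cont_diff n g"
  by (simp add: FE_def)

lemma FE_has_pd:
  "g \<in> FE \<Longrightarrow> ((\<lambda>s. g (p(c := s))) has_field_derivative pd c g p) (at (p c))"
  by (rule has_pd_at[of 0]) (rule FE_cont_diff)

lemma FE_const: "(\<lambda>p. a) \<in> FE"
  by (auto simp: FE_def cont_diff_const depends_only_on_def intro: exI[of _ "{}"])

lemma FE_coord: "(\<lambda>p. p c) \<in> FE"
  by (auto simp: FE_def cont_diff_coord depends_only_on_def intro!: exI[of _ "{c}"])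

text \<open>Finite dependence passes to every pointwise combination through the union of the two
  coordinate sets, so only smoothness is left to check.\<close>

lemma FE_combine:
  assumes "g \<in> FE" "h \<in> FE" "\<And>n. cont_diff n (\<lambda>p. F (g p) (h p))"
  shows "(\<lambda>p. F (g p) (h p)) \<in> FE"
proof -
  obtain C D where CD: "finite C" "depends_only_on C g" "finite D" "depends_only_on D h"
    using assms by (auto simp: FE_def)
  have "depends_only_on (C \<union> D) (\<lambda>p. F (g p) (h p))"
    using CD unfolding depends_only_on_def by (metis UnI1 UnI2)
  with CD assms(3) show ?thesis
    unfolding FE_def by (auto intro!: exI[of _ "C \<union> D"])
qed

lemma FE_add: "g \<in> FE \<Longrightarrow> h \<in> FE \<Longrightarrow> (\<lambda>p. g p + h p) \<in> FE"
  by (rule FE_combine[where F = "(+)"]) (auto intro: cont_diff_add FE_cont_diff)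

lemma FE_mult: "g \<in> FE \<Longrightarrow> h \<in> FE \<Longrightarrow> (\<lambda>p. g p * h p) \<in> FE"
  by (rule FE_combine[where F = "(*)"]) (auto intro: cont_diff_mult FE_cont_diff)

lemma FE_uminus: "g \<in> FE \<Longrightarrow> (\<lambda>p. - g p) \<in> FE"
  using FE_mult[OF FE_const[of "-1"], of g] by simp

lemma FE_diff: "g \<in> FE \<Longrightarrow> h \<in> FE \<Longrightarrow> (\<lambda>p. g p - h p) \<in> FE"
  using FE_add[OF _ FE_uminus, of g h] by simp

lemma FE_sum: "(\<And>i. i \<in> I \<Longrightarrow> g i \<in> FE) \<Longrightarrow> (\<lambda>p. \<Sum>i\<in>I. g i p) \<in> FE"
  by (induction I rule: infinite_finite_induct) (auto intro: FE_add FE_const)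

lemma pd_eq_zero:
  assumes "depends_only_on C g" "c \<notin> C"
  shows "pd c g = (\<lambda>p. 0)"
proof
  fix p :: "'a jet"
  have "g (p(c := s)) = g p" for s :: real
    using assms unfolding depends_only_on_def by (metis fun_upd_other)
  then show "pd c g p = 0" by (simp add: pd_def)
qed

text \<open>Points that agree on \<open>C\<close> may differ at a coordinate \<open>c\<close>
  outside \<open>C\<close>, and then the derivatives are taken at different places; there both
  vanish by \<open>pd_eq_zero\<close>.\<close>

lemma depends_only_on_pd:
  assumes "depends_only_on C g"
  shows "depends_only_on C (pd c g)"
proof (cases "c \<in> C")
  case True
  show ?thesis
    unfolding depends_only_on_def
  proof (intro allI impI)
    fix p p' :: "'a jet" assume *: "\<forall>c\<in>C. p c = p' c"
    then have "g (p(c := s)) = g (p'(c := s))" for s :: real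
      by (intro assms[unfolded depends_only_on_def, rule_format]) simp
    with * True show "pd c g p = pd c g p'" by (simp add: pd_def)
  qed
next
  case False
  then show ?thesis using pd_eq_zero[OF assms] by (simp add: depends_only_on_def)
qed

lemma FE_pd: "g \<in> FE \<Longrightarrow> pd c g \<in> FE"
  unfolding FE_def using depends_only_on_pd by (blast intro: cont_diff_pd)

lemma pd_add: "g \<in> FE \<Longrightarrow> h \<in> FE \<Longrightarrow> pd c (\<lambda>p. g p + h p) = (\<lambda>p. pd c g p + pd c h p)"
  by (intro ext pd_eqI DERIV_add FE_has_pd)

lemma pd_mult:
  "g \<in> FE \<Longrightarrow> h \<in> FE \<Longrightarrow> pd c (\<lambda>p. g p * h p) = (\<lambda>p. pd c g p * h p + g p * pd c h p)"
proof (intro ext pd_eqI)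
  fix p :: "'a jet" assume "g \<in> FE" "h \<in> FE"
  then show "((\<lambda>s. g (p(c := s)) * h (p(c := s))) has_field_derivative
      pd c g p * h p + g p * pd c h p) (at (p c))"
    by (intro DERIV_cong[OF DERIV_mult[OF FE_has_pd FE_has_pd]]) simp_all
qed

lemma pd_const: "pd c (\<lambda>p. a) = (\<lambda>p. 0)"
  by (simp add: pd_def)

lemma pd_coord: "pd c (\<lambda>p. p d) = (\<lambda>p. if c = d then 1 else 0)"
  by (auto simp: pd_def fun_eq_iff)

lemma pd_sum:
  "(\<And>i. i \<in> I \<Longrightarrow> g i \<in> FE) \<Longrightarrow> pd c (\<lambda>p. \<Sum>i\<in>I. g i p) = (\<lambda>p. \<Sum>i\<in>I. pd c (g i) p)"
proof (induction I rule: infinite_finite_induct)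
  case (insert i I)
  then show ?case by (simp add: pd_add FE_sum)
qed (auto simp: pd_const)

text \<open>Schwarz's theorem in the coordinate plane through \<open>p\<close> in the directions
  \<open>c\<close> and \<open>d\<close>.\<close>

lemma pd_commute:
  assumes "g \<in> FE"
  shows "pd c (pd d g) = pd d (pd c g)"
proof (cases "c = d")
  case False
  show ?thesis
  proof
    fix p :: "'a jet"
    let ?P = "\<lambda>s t. p(c := s, d := t)"
    have comm: "?P s t = p(d := t, c := s)" for s t
      using False by (auto simp: fun_eq_iff)
    have has: "((\<lambda>s. g' (q(e := s))) has_field_derivative pd e g' (q(e := s))) (at s)"
      if "g' \<in> FE" for g' and q :: "'a jet" and e s
      using has_pd[OF FE_cont_diff[OF that]] .
    \<comment> \<open>The parametrization of the plane is continuous into the product topology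
      because each of its coordinates is.\<close>
    have cont: "continuous_on UNIV (\<lambda>(s, t). g' (?P s t))" if "g' \<in> FE" for g'
    proof -
      have "continuous_on UNIV (\<lambda>z. ?P (fst z) (snd z))"
      proof (rule continuous_on_coordinatewise_then_product)
        fix i
        show "continuous_on UNIV (\<lambda>z. ?P (fst z) (snd z) i)"
          by (cases "i = d"; cases "i = c") (auto intro: continuous_intros)
      qed
      then have "continuous_on UNIV (\<lambda>z. g' (?P (fst z) (snd z)))"
        by (rule continuous_on_compose2[OF cont_diff_continuous[OF FE_cont_diff[OF that, of 0]]]) simp
      then show ?thesis by (simp add: case_prod_unfold)
    qed
    have "pd d (pd c g) (?P (p c) (p d)) = pd c (pd d g) (?P (p c) (p d))"
    proof (rule mixed_derivatives_eq[of "\<lambda>s t. g (?P s t)"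
          "\<lambda>s t. pd c g (?P s t)" "\<lambda>s t. pd d g (?P s t)"
          "\<lambda>s t. pd d (pd c g) (?P s t)" "\<lambda>s t. pd c (pd d g) (?P s t)"])
      fix s t
      show "((\<lambda>s. g (?P s t)) has_field_derivative pd c g (?P s t)) (at s)"
        "((\<lambda>s. pd d g (?P s t)) has_field_derivative pd c (pd d g) (?P s t)) (at s)"
        unfolding comm using assms by (auto intro!: has FE_pd)
    qed (use assms in \<open>auto intro!: has cont FE_pd\<close>)
    then show "pd c (pd d g) p = pd d (pd c g) p" by simp
  qed
qed simp

section \<open>Total and evolutionary derivatives\<close>

text \<open>Turns sums over all jet coordinates into finite sums whose range does not depend on the
  point, so that they can be differentiated termwise.\<close>

lemma FE_finite_order:
  assumes "g \<in> FE"
  obtains n where "\<And>j k. n \<le> k \<Longrightarrow> pd (CU j k) g = (\<lambda>p. 0)"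
proof -
  obtain C where C: "finite C" "depends_only_on C g"
    using assms by (auto simp: FE_def)
  define n where "n = Suc (Max (insert 0 {k. \<exists>j. CU j k \<in> C}))"
  have "{k. \<exists>j. CU j k \<in> C} \<subseteq> (\<lambda>c. case c of CU j k \<Rightarrow> k | _ \<Rightarrow> 0) ` C"
    by force
  then have fin: "finite {k. \<exists>j. CU j k \<in> C}"
    using C(1) finite_surj by blast
  have "CU j k \<notin> C" if "n \<le> k" for j k
  proof
    assume "CU j k \<in> C"
    then have "k \<le> Max (insert 0 {k. \<exists>j. CU j k \<in> C})"
      using fin by (intro Max_ge) auto
    with that show False by (simp add: n_def)
  qed
  then show thesis
    using pd_eq_zero[OF C(2)] that by blast
qed

lemma Sum_any_jet:
  assumes "\<And>a k. (n :: nat) \<le> k \<Longrightarrow> z a k = 0"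
  shows "Sum_any (\<lambda>(a, k). z a k) = (\<Sum>a\<in>UNIV. \<Sum>k<n. z (a :: 'm::finite) k)"
proof -
  have "k < n" if "z a k \<noteq> 0" for a k
    using assms[of k a] that by (cases "k < n") auto
  then have "Sum_any (\<lambda>(a, k). z a k) = (\<Sum>(a, k)\<in>UNIV \<times> {..<n}. z a k)"
    by (intro Sum_any.expand_superset) auto
  then show ?thesis by (simp add: sum.cartesian_product)
qed

lemma Ev_eq:
  fixes g :: "'m::finite func"
  assumes "\<And>j k. n \<le> k \<Longrightarrow> pd (CU j k) g = (\<lambda>p. 0)"
  shows "Ev \<phi> g = (\<lambda>p. \<Sum>j\<in>UNIV. \<Sum>k<n. (Dx ^^ k) (\<phi> j) p * pd (CU j k) g p)"
  unfolding Ev_def by (intro ext Sum_any_jet) (simp add: assms)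

lemma Dx_eq:
  fixes g :: "'m::finite func"
  assumes "\<And>j k. n \<le> k \<Longrightarrow> pd (CU j k) g = (\<lambda>p. 0)"
  shows "Dx g = (\<lambda>p. pd CX g p + (\<Sum>j\<in>UNIV. \<Sum>k<n. p (CU j (Suc k)) * pd (CU j k) g p))"
  unfolding Dx_def by (intro ext arg_cong2[of _ _ _ _ "(+)"] refl Sum_any_jet) (simp add: assms)

lemma FE_Dx:
  fixes g :: "'m::finite func"
  assumes "g \<in> FE"
  shows "Dx g \<in> FE"
  by (rule FE_finite_order[OF assms], subst Dx_eq) (use assms in
    \<open>auto intro!: FE_add FE_sum FE_mult FE_pd FE_coord\<close>)

lemma FE_Dx_pow: "g \<in> FE \<Longrightarrow> (Dx ^^ k) g \<in> FE" for g :: "'m::finite func"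
  by (induction k) (auto intro: FE_Dx)

lemma kappa_FE: "\<phi> \<in> kappa \<Longrightarrow> \<phi> j \<in> FE"
  by (simp add: kappa_def)

lemma FE_Ev:
  fixes g :: "'m::finite func"
  assumes "\<phi> \<in> kappa" "g \<in> FE"
  shows "Ev \<phi> g \<in> FE"
  by (rule FE_finite_order[OF assms(2)], subst Ev_eq) (use assms in
    \<open>auto intro!: FE_sum FE_mult FE_pd FE_Dx_pow kappa_FE[OF assms(1)]\<close>)

section \<open>Linearity and Leibniz rules for \<open>Dx\<close> and
  \<open>Ev \<phi>\<close>\<close>

lemma Dx_Ev_add:
  fixes g h :: "'m::finite func"
  assumes "g \<in> FE" "h \<in> FE"
  shows Dx_add: "Dx (\<lambda>p. g p + h p) = (\<lambda>p. Dx g p + Dx h p)"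
    and Ev_add: "Ev \<phi> (\<lambda>p. g p + h p) = (\<lambda>p. Ev \<phi> g p + Ev \<phi> h p)"
proof -
  obtain n1 where n1: "\<And>j k. n1 \<le> k \<Longrightarrow> pd (CU j k) g = (\<lambda>p. 0)"
    using FE_finite_order[OF assms(1)] by blast
  obtain n2 where n2: "\<And>j k. n2 \<le> k \<Longrightarrow> pd (CU j k) h = (\<lambda>p. 0)"
    using FE_finite_order[OF assms(2)] by blast
  \<comment> \<open>With a common order the finite sums for all three functions share one
    range.\<close>
  define n where "n = max n1 n2"
  have n: "pd (CU j k) g = (\<lambda>p. 0)" "pd (CU j k) h = (\<lambda>p. 0)"
    "pd (CU j k) (\<lambda>p. g p + h p) = (\<lambda>p. 0)" if "n \<le> k" for j k
    using that n1[of k j] n2[of k j] assms by (auto simp: n_def pd_add)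
  show "Dx (\<lambda>p. g p + h p) = (\<lambda>p. Dx g p + Dx h p)"
    "Ev \<phi> (\<lambda>p. g p + h p) = (\<lambda>p. Ev \<phi> g p + Ev \<phi> h p)"
    by (simp_all add: Dx_eq[OF n(1)] Dx_eq[OF n(2)] Dx_eq[OF n(3)] Ev_eq[OF n(1)] Ev_eq[OF n(2)]
        Ev_eq[OF n(3)] pd_add assms sum.distrib algebra_simps)
qed

lemma Dx_Ev_mult:
  fixes g h :: "'m::finite func"
  assumes "g \<in> FE" "h \<in> FE"
  shows Dx_mult: "Dx (\<lambda>p. g p * h p) = (\<lambda>p. Dx g p * h p + g p * Dx h p)"
    and Ev_mult: "Ev \<phi> (\<lambda>p. g p * h p) = (\<lambda>p. Ev \<phi> g p * h p + g p * Ev \<phi> h p)"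
proof -
  obtain n1 where n1: "\<And>j k. n1 \<le> k \<Longrightarrow> pd (CU j k) g = (\<lambda>p. 0)"
    using FE_finite_order[OF assms(1)] by blast
  obtain n2 where n2: "\<And>j k. n2 \<le> k \<Longrightarrow> pd (CU j k) h = (\<lambda>p. 0)"
    using FE_finite_order[OF assms(2)] by blast
  define n where "n = max n1 n2"
  have n: "pd (CU j k) g = (\<lambda>p. 0)" "pd (CU j k) h = (\<lambda>p. 0)"
    "pd (CU j k) (\<lambda>p. g p * h p) = (\<lambda>p. 0)" if "n \<le> k" for j k
    using that n1[of k j] n2[of k j] assms by (auto simp: n_def pd_mult)
  show "Dx (\<lambda>p. g p * h p) = (\<lambda>p. Dx g p * h p + g p * Dx h p)"
    "Ev \<phi> (\<lambda>p. g p * h p) = (\<lambda>p. Ev \<phi> g p * h p + g p * Ev \<phi> h p)"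
    by (simp_all add: Dx_eq[OF n(1)] Dx_eq[OF n(2)] Dx_eq[OF n(3)] Ev_eq[OF n(1)] Ev_eq[OF n(2)]
        Ev_eq[OF n(3)] pd_mult assms sum.distrib algebra_simps sum_distrib_left sum_distrib_right)
qed

lemma Dx_const: "Dx (\<lambda>p. a) = (\<lambda>p. 0)"
  by (simp add: Dx_def pd_const case_prod_unfold)

lemma Ev_const: "Ev \<phi> (\<lambda>p. a) = (\<lambda>p. 0)"
  by (simp add: Ev_def pd_const case_prod_unfold)

lemma Dx_sum:
  fixes g :: "'i \<Rightarrow> 'm::finite func"
  shows "(\<And>i. i \<in> I \<Longrightarrow> g i \<in> FE) \<Longrightarrow> Dx (\<lambda>p. \<Sum>i\<in>I. g i p) = (\<lambda>p. \<Sum>i\<in>I. Dx (g i) p)"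
proof (induction I rule: infinite_finite_induct)
  case (insert i I)
  then show ?case by (simp add: Dx_add FE_sum)
qed (auto simp: Dx_const)

lemma Ev_sum:
  fixes g :: "'i \<Rightarrow> 'm::finite func"
  shows "(\<And>i. i \<in> I \<Longrightarrow> g i \<in> FE) \<Longrightarrow> Ev \<phi> (\<lambda>p. \<Sum>i\<in>I. g i p) = (\<lambda>p. \<Sum>i\<in>I. Ev \<phi> (g i) p)"
proof (induction I rule: infinite_finite_induct)
  case (insert i I)
  then show ?case by (simp add: Ev_add FE_sum)
qed (auto simp: Ev_const)

lemma Dx_uminus: "g \<in> FE \<Longrightarrow> Dx (\<lambda>p. - g p) = (\<lambda>p. - Dx g p)" for g :: "'m::finite func"
  using Dx_mult[OF FE_const[of "-1"], of g] by (simp add: Dx_const)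

lemma Dx_pow_add:
  fixes g h :: "'m::finite func"
  assumes "g \<in> FE" "h \<in> FE"
  shows "(Dx ^^ k) (\<lambda>p. g p + h p) = (\<lambda>p. (Dx ^^ k) g p + (Dx ^^ k) h p)"
  by (induction k) (simp_all add: Dx_add FE_Dx_pow assms)

lemma Dx_pow_uminus:
  fixes g :: "'m::finite func"
  assumes "g \<in> FE"
  shows "(Dx ^^ k) (\<lambda>p. - g p) = (\<lambda>p. - (Dx ^^ k) g p)"
  by (induction k) (simp_all add: Dx_uminus FE_Dx_pow assms)

text \<open>The extra term comes from differentiating the coefficients
  \<open>p (CU j' (Suc k'))\<close> of \<open>Dx\<close>; no such coefficient involves a coordinate
  of order 0.\<close>

lemma pd_Dx:
  fixes g :: "'m::finite func"
  assumes "g \<in> FE"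
  shows "pd (CU j k) (Dx g)
    = (\<lambda>p. Dx (pd (CU j k) g) p + (if k = 0 then 0 else pd (CU j (k - 1)) g p))"
proof -
  obtain n1 where n1: "\<And>j k. n1 \<le> k \<Longrightarrow> pd (CU j k) g = (\<lambda>p. 0)"
    using FE_finite_order[OF assms] by blast
  \<comment> \<open>Including \<open>k\<close> ensures that the index \<open>k - 1\<close> of the
    extra term lies in the range of summation when \<open>k > 0\<close>.\<close>
  define n where "n = max n1 k"
  have n: "pd (CU j' k') g = (\<lambda>p. 0)" if "n \<le> k'" for j' k'
    using that n1[of k' j'] by (auto simp: n_def)
  have n': "pd (CU j' k') (pd (CU j k) g) = (\<lambda>p. 0)" if "n \<le> k'" for j' k'
    by (subst pd_commute) (simp_all add: assms n that pd_const)
  have *: "pd (CU j k) (\<lambda>p. p (CU j' (Suc k')) * pd (CU j' k') g p) = (\<lambda>p.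
      (if j' = j \<and> Suc k' = k then pd (CU j' k') g p else 0)
      + p (CU j' (Suc k')) * pd (CU j' k') (pd (CU j k) g) p)" for j' k'
    by (subst pd_mult) (auto simp: FE_coord FE_pd assms pd_coord pd_commute[of g "CU j k"])
  have delta: "(\<Sum>j'\<in>UNIV. \<Sum>k'<n. if j' = j \<and> Suc k' = k then pd (CU j' k') g p else 0)
      = (if k = 0 then 0 else pd (CU j (k - 1)) g p)" for p
  proof (cases k)
    case (Suc i)
    have "(\<Sum>j'\<in>UNIV. \<Sum>k'<n. if j' = j \<and> Suc k' = k then pd (CU j' k') g p else 0)
      = (\<Sum>j'\<in>UNIV. if j' = j then \<Sum>k'<n. if k' = i then pd (CU j' k') g p else 0 else 0)"
      by (intro sum.cong) (auto simp: Suc)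
    also have "\<dots> = pd (CU j i) g p"
      using Suc by (simp add: n_def)
    finally show ?thesis using Suc by simp
  qed simp
  have "pd (CU j k) (Dx g) = (\<lambda>p. pd CX (pd (CU j k) g) p + (\<Sum>j'\<in>UNIV. \<Sum>k'<n.
      (if j' = j \<and> Suc k' = k then pd (CU j' k') g p else 0)
      + p (CU j' (Suc k')) * pd (CU j' k') (pd (CU j k) g) p))"
    by (subst Dx_eq[OF n])
      (simp_all add: pd_add pd_sum FE_pd FE_sum FE_mult FE_coord assms * pd_commute[of g "CU j k" CX])
  then show ?thesis
    unfolding sum.distrib delta by (simp add: Dx_eq[OF n'] ac_simps)
qed

text \<open>After an index shift the extra term of \<open>pd_Dx\<close> becomes the part of
  \<open>Dx (Ev \<phi> g)\<close> in which \<open>Dx\<close> hits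
  \<open>(Dx ^^ k) (\<phi> j)\<close>.\<close>

lemma Ev_Dx:
  fixes g :: "'m::finite func"
  assumes "\<phi> \<in> kappa" "g \<in> FE"
  shows "Ev \<phi> (Dx g) = Dx (Ev \<phi> g)"
proof -
  obtain n where n: "\<And>j k. n \<le> k \<Longrightarrow> pd (CU j k) g = (\<lambda>p. 0)"
    using FE_finite_order[OF assms(2)] by blast
  \<comment> \<open>\<open>Dx\<close> raises the order by at most one. Of the two sums up to
    \<open>Suc n\<close>, one then loses its first term and the other its last.\<close>
  have n1: "pd (CU j k) (Dx g) = (\<lambda>p. 0)" if "Suc n \<le> k" for j k
    using that n[of k j] n[of "k - 1" j] by (auto simp: pd_Dx assms Dx_const)
  have D: "(Dx ^^ k) (\<phi> j) \<in> FE" "pd c g \<in> FE" for k j c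
    using assms by (auto intro: FE_Dx_pow kappa_FE[OF assms(1)] FE_pd)
  have "Dx (Ev \<phi> g) p = (\<Sum>j\<in>UNIV. \<Sum>k<n. (Dx ^^ k) (\<phi> j) p * Dx (pd (CU j k) g) p)
      + (\<Sum>j\<in>UNIV. \<Sum>k<n. (Dx ^^ Suc k) (\<phi> j) p * pd (CU j k) g p)" for p
    by (simp add: Ev_eq[OF n] Dx_sum Dx_mult FE_sum FE_mult D sum.distrib)
  moreover have "Ev \<phi> (Dx g) p = (\<Sum>j\<in>UNIV. \<Sum>k<Suc n. (Dx ^^ k) (\<phi> j) p * Dx (pd (CU j k) g) p)
      + (\<Sum>j\<in>UNIV. \<Sum>k<Suc n. (Dx ^^ k) (\<phi> j) p * (if k = 0 then 0 else pd (CU j (k - 1)) g p))" for p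
    by (subst Ev_eq[OF n1])
      (simp_all add: pd_Dx assms ring_distribs sum.distrib del: sum.lessThan_Suc)
  moreover have "(\<Sum>k<Suc n. (Dx ^^ k) (\<phi> j) p * (if k = 0 then 0 else pd (CU j (k - 1)) g p))
      = (\<Sum>k<n. (Dx ^^ Suc k) (\<phi> j) p * pd (CU j k) g p)" for j p
    by (subst sum.lessThan_Suc_shift) simp
  moreover have "(\<Sum>k<Suc n. (Dx ^^ k) (\<phi> j) p * Dx (pd (CU j k) g) p)
      = (\<Sum>k<n. (Dx ^^ k) (\<phi> j) p * Dx (pd (CU j k) g) p)" for j p
    by (simp add: n Dx_const)
  ultimately show ?thesis by (intro ext) (simp del: sum.lessThan_Suc)
qed

lemma Ev_Dx_pow:
  fixes g :: "'m::finite func"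
  assumes "\<phi> \<in> kappa" "g \<in> FE"
  shows "Ev \<phi> ((Dx ^^ k) g) = (Dx ^^ k) (Ev \<phi> g)"
  by (induction k) (simp_all add: Ev_Dx FE_Dx_pow assms)

section \<open>Linear differential operators and the bracket\<close>

lemma kappa_add: "\<phi> \<in> kappa \<Longrightarrow> \<psi> \<in> kappa \<Longrightarrow> (\<lambda>l p. \<phi> l p + \<psi> l p) \<in> kappa"
  and kappa_diff: "\<phi> \<in> kappa \<Longrightarrow> \<psi> \<in> kappa \<Longrightarrow> (\<lambda>l p. \<phi> l p - \<psi> l p) \<in> kappa"
  and kappa_uminus: "\<phi> \<in> kappa \<Longrightarrow> (\<lambda>l p. - \<phi> l p) \<in> kappa"
  by (auto simp: kappa_def intro: FE_add FE_diff FE_uminus)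

lemma kappa_Ev: "\<theta> \<in> kappa \<Longrightarrow> \<phi> \<in> kappa \<Longrightarrow> (\<lambda>l. Ev \<theta> (\<phi> l)) \<in> kappa"
  for \<phi> :: "'m::finite \<Rightarrow> 'm func"
  by (auto simp: kappa_def intro!: FE_Ev)

lemma cdo_FE: "R \<in> cdo \<Longrightarrow> R l j i \<in> FE"
  by (simp add: cdo_def)

text \<open>One bound serves all matrix entries because the index type is finite.\<close>

lemma cdo_finite_order:
  fixes R :: "'m::finite cdo"
  assumes "R \<in> cdo"
  obtains n where "\<And>l j i. n \<le> i \<Longrightarrow> R l j i = (\<lambda>p. 0)"
proof -
  let ?I = "insert 0 (\<Union>l. \<Union>j. {i. R l j i \<noteq> (\<lambda>p. 0)})"
  have fin: "finite ?I"
    using assms by (simp add: cdo_def)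
  have "R l j i = (\<lambda>p. 0)" if "Suc (Max ?I) \<le> i" for l j i
  proof (rule ccontr)
    assume "R l j i \<noteq> (\<lambda>p. 0)"
    then have "i \<le> Max ?I" using fin by (intro Max_ge) auto
    with that show False by simp
  qed
  with that show thesis by blast
qed

lemma cdo_apply_eq:
  fixes R :: "'m::finite cdo"
  assumes "\<And>l j i. n \<le> i \<Longrightarrow> R l j i = (\<lambda>p. 0)"
  shows "cdo_apply R \<phi> = (\<lambda>l p. \<Sum>j\<in>UNIV. \<Sum>i<n. R l j i p * (Dx ^^ i) (\<phi> j) p)"
  unfolding cdo_apply_def by (intro ext Sum_any_jet) (simp add: assms)

text \<open>Used for \<open>Ev \<theta>\<close> and \<open>pd c\<close>; fixing zero keeps the
  coefficients finitely supported.\<close>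

lemma cdo_map:
  assumes "R \<in> cdo" "\<And>g. g \<in> FE \<Longrightarrow> F g \<in> FE" "F (\<lambda>p. 0) = (\<lambda>p. 0)"
  shows "(\<lambda>l j i. F (R l j i)) \<in> cdo"
proof -
  have "finite {i. F (R l j i) \<noteq> (\<lambda>p. 0)}" for l j
    using assms(1,3) by (auto simp: cdo_def intro: rev_finite_subset[of "{i. R l j i \<noteq> (\<lambda>p. 0)}"])
  with assms(1,2) show ?thesis by (simp add: cdo_def)
qed

lemma kappa_cdo_apply:
  fixes R :: "'m::finite cdo"
  assumes "R \<in> cdo" "\<phi> \<in> kappa"
  shows "cdo_apply R \<phi> \<in> kappa"
  using cdo_FE[OF assms(1)] assms(2) unfolding kappa_def
  by (rule_tac cdo_finite_order[OF assms(1)], subst cdo_apply_eq)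
    (auto intro!: FE_sum FE_mult FE_Dx_pow)

lemma cdo_apply_add:
  fixes R :: "'m::finite cdo"
  assumes "R \<in> cdo" "\<phi> \<in> kappa" "\<psi> \<in> kappa"
  shows "cdo_apply R (\<lambda>l p. \<phi> l p + \<psi> l p) = (\<lambda>l p. cdo_apply R \<phi> l p + cdo_apply R \<psi> l p)"
proof -
  obtain n where "\<And>l j i. n \<le> i \<Longrightarrow> R l j i = (\<lambda>p. 0)"
    using cdo_finite_order[OF assms(1)] by blast
  note eq = cdo_apply_eq[of n R, OF this]
  show ?thesis
    by (simp add: eq Dx_pow_add kappa_FE assms sum.distrib distrib_left)
qed

lemma cdo_apply_uminus:
  fixes R :: "'m::finite cdo"
  assumes "R \<in> cdo" "\<phi> \<in> kappa"
  shows "cdo_apply R (\<lambda>l p. - \<phi> l p) = (\<lambda>l p. - cdo_apply R \<phi> l p)"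
proof -
  obtain n where "\<And>l j i. n \<le> i \<Longrightarrow> R l j i = (\<lambda>p. 0)"
    using cdo_finite_order[OF assms(1)] by blast
  note eq = cdo_apply_eq[of n R, OF this]
  show ?thesis
    by (simp add: eq Dx_pow_uminus kappa_FE assms sum_negf)
qed

lemma cdo_apply_diff:
  fixes R :: "'m::finite cdo"
  assumes "R \<in> cdo" "\<phi> \<in> kappa" "\<psi> \<in> kappa"
  shows "cdo_apply R (\<lambda>l p. \<phi> l p - \<psi> l p) = (\<lambda>l p. cdo_apply R \<phi> l p - cdo_apply R \<psi> l p)"
  using cdo_apply_add[OF assms(1,2) kappa_uminus[OF assms(3)]] cdo_apply_uminus[OF assms(1,3)]
  by simp

definition ev_cdo :: "('m \<Rightarrow> 'm func) \<Rightarrow> 'm cdo \<Rightarrow> 'm cdo" where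
  "ev_cdo \<theta> R = (\<lambda>l j i. Ev \<theta> (R l j i))"

lemma ev_cdo_in_cdo:
  fixes R :: "'m::finite cdo"
  shows "\<theta> \<in> kappa \<Longrightarrow> R \<in> cdo \<Longrightarrow> ev_cdo \<theta> R \<in> cdo"
  unfolding ev_cdo_def by (rule cdo_map[where F = "Ev \<theta>"]) (simp_all add: FE_Ev Ev_const)

text \<open>Leibniz rule on each term, followed by moving \<open>Ev \<theta>\<close> past the powers
  of \<open>Dx\<close> with \<open>Ev_Dx_pow\<close>.\<close>

lemma Ev_cdo_apply:
  fixes R :: "'m::finite cdo"
  assumes "\<theta> \<in> kappa" "R \<in> cdo" "\<phi> \<in> kappa"
  shows "Ev \<theta> (cdo_apply R \<phi> l)
    = (\<lambda>p. cdo_apply (ev_cdo \<theta> R) \<phi> l p + cdo_apply R (\<lambda>j. Ev \<theta> (\<phi> j)) l p)"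
proof -
  obtain n where n: "\<And>l j i. n \<le> i \<Longrightarrow> R l j i = (\<lambda>p. 0)"
    using cdo_finite_order[OF assms(2)] by blast
  then have "\<And>l j i. n \<le> i \<Longrightarrow> ev_cdo \<theta> R l j i = (\<lambda>p. 0)"
    by (simp add: ev_cdo_def Ev_const)
  note eq = cdo_apply_eq[of n R, OF n] cdo_apply_eq[of n "ev_cdo \<theta> R", OF this]
  show ?thesis
    by (simp add: eq Ev_sum Ev_mult FE_sum FE_mult FE_Dx_pow kappa_FE[OF assms(3)]
        cdo_FE[OF assms(2)] Ev_Dx_pow assms(1) sum.distrib) (simp add: ev_cdo_def)
qed

text \<open>
  Writing \<open>R\<^bsub>\<phi>\<^esub>\<close> for \<open>ev_cdo \<phi> R\<close>, this is \<open>S\<^bsub>R\<phi>\<^esub>(\<psi>) - S(R\<^bsub>\<phi>\<^esub>(\<psi>))\<close>.  Its two terms match the even and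
  the odd part of \<open>Q\<^sub>R(\<N>\<^sub>S)\<close>.
\<close>

definition fn_half :: "'m cdo \<Rightarrow> 'm cdo \<Rightarrow> ('m \<Rightarrow> 'm func) \<Rightarrow> ('m \<Rightarrow> 'm func) \<Rightarrow> 'm \<Rightarrow> 'm func" where
  "fn_half R S \<phi> \<psi> = (\<lambda>l p. cdo_apply (ev_cdo (cdo_apply R \<phi>) S) \<psi> l p
     - cdo_apply S (cdo_apply (ev_cdo \<phi> R) \<psi>) l p)"

text \<open>By \<open>Ev_cdo_apply\<close>, the term \<open>Ev \<phi> (cdo_apply S \<psi> l)\<close>
  contains \<open>S\<close> applied to \<open>Ev \<phi>\<close> of \<open>\<psi>\<close>, which
  cancels against \<open>S\<close> applied to the Jacobi bracket; likewise with
  \<open>\<phi>\<close> and \<open>\<psi>\<close> exchanged. Derivatives along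
  \<open>cdo_apply S \<phi>\<close> and \<open>cdo_apply S \<psi>\<close> survive.\<close>

lemma cdo_apply_defect:
  fixes R S :: "'m::finite cdo"
  assumes "R \<in> cdo" "S \<in> cdo" "\<phi> \<in> kappa" "\<psi> \<in> kappa"
  shows "cdo_apply R (\<lambda>l p. jacobi (cdo_apply S \<phi>) \<psi> l p + jacobi \<phi> (cdo_apply S \<psi>) l p
      - cdo_apply S (jacobi \<phi> \<psi>) l p)
    = (\<lambda>l p. cdo_apply R (\<lambda>l. Ev (cdo_apply S \<phi>) (\<psi> l)) l p
      - cdo_apply R (\<lambda>l. Ev (cdo_apply S \<psi>) (\<phi> l)) l p
      + (cdo_apply R (cdo_apply (ev_cdo \<phi> S) \<psi>) l p
      - cdo_apply R (cdo_apply (ev_cdo \<psi> S) \<phi>) l p))"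
proof -
  note kappa = kappa_add kappa_diff kappa_Ev kappa_cdo_apply ev_cdo_in_cdo assms
  have "cdo_apply S (jacobi \<phi> \<psi>)
      = (\<lambda>l p. cdo_apply S (\<lambda>l. Ev \<phi> (\<psi> l)) l p - cdo_apply S (\<lambda>l. Ev \<psi> (\<phi> l)) l p)"
    unfolding jacobi_def by (intro cdo_apply_diff kappa)
  then have "(\<lambda>l p. jacobi (cdo_apply S \<phi>) \<psi> l p + jacobi \<phi> (cdo_apply S \<psi>) l p
      - cdo_apply S (jacobi \<phi> \<psi>) l p)
    = (\<lambda>l p. Ev (cdo_apply S \<phi>) (\<psi> l) p - Ev (cdo_apply S \<psi>) (\<phi> l) p
      + (cdo_apply (ev_cdo \<phi> S) \<psi> l p - cdo_apply (ev_cdo \<psi> S) \<phi> l p))"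
    by (simp add: jacobi_def[of "cdo_apply S \<phi>"] jacobi_def[of \<phi> "cdo_apply S \<psi>"] Ev_cdo_apply
        assms algebra_simps)
  \<comment> \<open>The argument of \<open>R\<close> is first replaced as a whole; only then is it
    split by additivity.\<close>
  then show ?thesis
    by (simp only:) (simp add: cdo_apply_add cdo_apply_diff kappa)
qed

text \<open>Expanding the two outer Jacobi brackets by \<open>Ev_cdo_apply\<close> produces exactly
  the derivative terms that survive in \<open>cdo_apply_defect\<close>, so these cancel too and only
  derivatives of coefficients remain.\<close>

lemma fn_bracket_eq:
  fixes R S :: "'m::finite cdo"
  assumes "R \<in> cdo" "S \<in> cdo" "\<phi> \<in> kappa" "\<psi> \<in> kappa"
  shows "fn_bracket (cdo_apply R) (cdo_apply S) \<phi> \<psi> l p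
    = (fn_half R S \<phi> \<psi> l p + fn_half S R \<phi> \<psi> l p) - (fn_half R S \<psi> \<phi> l p + fn_half S R \<psi> \<phi> l p)"
  unfolding fn_bracket_def cdo_apply_defect[OF assms] cdo_apply_defect[OF assms(2,1,3,4)]
  by (simp add: fn_half_def jacobi_def Ev_cdo_apply kappa_cdo_apply assms)

section \<open>Odd variables\<close>

text \<open>An infinite \<open>A\<close> has an infinite power set, and a sum over an infinite set
  is 0 by convention. This is the source of the finiteness conditions below.\<close>

lemma gmult_infinite: "infinite A \<Longrightarrow> (N \<star> M) A p = 0"
  by (simp add: gmult_def)

lemma gmult_add_left: "(\<lambda>A p. N A p + N' A p) \<star> M = (\<lambda>A p. (N \<star> M) A p + (N' \<star> M) A p)"
  and gmult_add_right: "M \<star> (\<lambda>A p. N A p + N' A p) = (\<lambda>A p. (M \<star> N) A p + (M \<star> N') A p)"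
  by (simp_all add: gmult_def sum.distrib algebra_simps)

lemma gmult_scale_left: "(\<lambda>A p. t p * N A p) \<star> M = (\<lambda>A p. t p * (N \<star> M) A p)"
  and gmult_scale_right: "M \<star> (\<lambda>A p. t p * N A p) = (\<lambda>A p. t p * (M \<star> N) A p)"
  by (simp_all add: gmult_def sum_distrib_left algebra_simps)

lemma gmult_uminus_right: "M \<star> (\<lambda>A p. - N A p) = (\<lambda>A p. - (M \<star> N) A p)"
  by (simp add: gmult_def sum_negf)

lemma gmult_zero_left: "(\<lambda>A p. 0) \<star> M = (\<lambda>A p. 0)"
  and gmult_zero_right: "M \<star> (\<lambda>A p. 0) = (\<lambda>A p. 0)"
  by (simp_all add: gmult_def)

lemma ksign_empty_right [simp]: "ksign A {} = 1"
  by (simp add: ksign_def)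

lemma gmult_embed: "(N \<star> embed g) A p = (if finite A then N A p * g p else 0)"
proof (cases "finite A")
  case True
  have "(N \<star> embed g) A p = (\<Sum>B\<in>Pow A. if B = A then N A p * g p else 0)"
    unfolding gmult_def by (intro sum.cong) (auto simp: embed_def)
  with True show ?thesis by simp
qed (simp add: gmult_infinite)

lemma qvar_gmult:
  "(qvar g \<star> M) A p = (if finite A \<and> g \<in> A then ksign {g} (A - {g}) * M (A - {g}) p else 0)"
proof (cases "finite A")
  case True
  have "(qvar g \<star> M) A p
      = (\<Sum>B\<in>Pow A. if B = {g} then ksign {g} (A - {g}) * M (A - {g}) p else 0)"
    unfolding gmult_def by (intro sum.cong) (auto simp: qvar_def)
  with True show ?thesis by (simp add: Pow_def)
qed (simp add: gmult_infinite)

lemma ksign_singletons: "ksign {g} {h} = (if gen_less h g then - 1 else 1)"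
proof -
  have "{(b, c). b \<in> {g} \<and> c \<in> {h} \<and> gen_less c b} = (if gen_less h g then {(g, h)} else {})"
    by auto
  then show ?thesis by (simp add: ksign_def)
qed

lemma gen_less_total: "g \<noteq> h \<Longrightarrow> gen_less h g \<longleftrightarrow> \<not> gen_less g h"
  by (auto simp: gen_less_def prod_eq_iff)

lemma qvar_gmult_qvar:
  "(qvar g \<star> qvar h) A p = (if g \<noteq> h \<and> A = {g, h} then ksign {g} {h} else 0)"
proof -
  have "finite A \<and> g \<in> A \<and> A - {g} = {h} \<longleftrightarrow> g \<noteq> h \<and> A = {g, h}"
    by auto
  then show ?thesis
    unfolding qvar_gmult by (auto simp: qvar_def)
qed

lemma qvar_anticommute: "(qvar g \<star> qvar h) A p = - (qvar h \<star> qvar g) A p"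
  using gen_less_total[of g h]
  by (auto simp: qvar_gmult_qvar ksign_singletons insert_commute)

lemma pd_odd_qvar: "pd_odd k (qvar g) = (if k = g then embed (\<lambda>p. 1) else (\<lambda>A p. 0))"
  by (auto simp: pd_odd_def qvar_def embed_def fun_eq_iff)

text \<open>The minus sign comes from moving the right factor past the left one. For
  \<open>g = h\<close> the product is zero and the two terms on the right cancel.\<close>

lemma pd_odd_qvar_gmult_qvar:
  "pd_odd k (qvar g \<star> qvar h)
    = (\<lambda>A p. (if k = g then qvar h A p else 0) + (if k = h then - qvar g A p else 0))"
proof (intro ext)
  fix A p
  consider "k \<in> A" | "g = h" "k \<notin> A" | "k \<notin> A" "g \<noteq> h" "k = g" | "k \<notin> A" "g \<noteq> h" "k = h"
    | "k \<notin> A" "g \<noteq> h" "k \<noteq> g" "k \<noteq> h"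
    by blast
  then show "pd_odd k (qvar g \<star> qvar h) A p
      = (if k = g then qvar h A p else 0) + (if k = h then - qvar g A p else 0)"
  proof cases
    case 3
    then have "insert k A = {g, h} \<longleftrightarrow> A = {h}" by auto
    with 3 show ?thesis
      by (cases "A = {h}")
        (simp_all add: pd_odd_def qvar_gmult_qvar ksign_singletons, simp_all add: qvar_def)
  next
    case 4
    then have "insert k A = {g, h} \<longleftrightarrow> A = {g}" by auto
    with 4 show ?thesis
      using gen_less_total[of g h]
      by (cases "A = {g}")
        (simp_all add: pd_odd_def qvar_gmult_qvar ksign_singletons, simp_all add: qvar_def)
  next
    case 5
    then have "insert k A \<noteq> {g, h}" by auto
    with 5 show ?thesis
      by (simp add: pd_odd_def qvar_gmult_qvar)
  qed (simp_all add: pd_odd_def qvar_gmult_qvar, auto simp: qvar_def)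
qed

section \<open>The odd part of the lifted total derivative\<close>

definition Dq :: "'m::linorder lfunc \<Rightarrow> 'm lfunc" where
  "Dq N = (\<lambda>A p. Sum_any (\<lambda>(j, k). (qvar (j, Suc k) \<star> pd_odd (j, k) N) A p))"

lemma Dx_cov_eq: "Dx_cov N = (\<lambda>A p. Dx (N A) p + Dq N A p)"
  by (simp add: Dx_cov_def Dq_def)

text \<open>Splitting \<open>Sum_any\<close> needs finite supports. Whatever \<open>M\<close> is, a
  nonzero term forces \<open>(j, Suc k)\<close> into the finite set \<open>A\<close>.\<close>

lemma finite_support_Dq:
  "finite {x. (case x of (j, k) \<Rightarrow> (qvar (j, Suc k) \<star> M j k) A p) \<noteq> 0}"
proof (cases "finite A")
  case True
  have "{x. (case x of (j, k) \<Rightarrow> (qvar (j, Suc k) \<star> M j k) A p) \<noteq> 0}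
      \<subseteq> (\<lambda>(j, k). (j, k - 1)) ` A"
    by (force simp: qvar_gmult split: if_splits)
  with True show ?thesis by (meson finite_imageI finite_subset)
qed (simp add: gmult_infinite case_prod_unfold)

lemma pd_odd_add: "pd_odd k (\<lambda>A p. N A p + M A p) = (\<lambda>A p. pd_odd k N A p + pd_odd k M A p)"
  and pd_odd_scale: "pd_odd k (\<lambda>A p. t p * N A p) = (\<lambda>A p. t p * pd_odd k N A p)"
  by (auto simp: pd_odd_def fun_eq_iff algebra_simps)

lemma Dq_add: "Dq (\<lambda>A p. N A p + M A p) = (\<lambda>A p. Dq N A p + Dq M A p)"
proof (intro ext)
  fix A p
  show "Dq (\<lambda>A p. N A p + M A p) A p = Dq N A p + Dq M A p"
    unfolding Dq_def pd_odd_add gmult_add_right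
    by (subst Sum_any.distrib[symmetric, OF finite_support_Dq finite_support_Dq])
      (auto intro!: Sum_any.cong)
qed

text \<open>No regularity of \<open>t\<close> is required, since \<open>Dq\<close> acts on the odd
  variables alone.\<close>

lemma Dq_scale: "Dq (\<lambda>A p. t p * N A p) = (\<lambda>A p. t p * Dq N A p)"
proof (intro ext)
  fix A p
  show "Dq (\<lambda>A p. t p * N A p) A p = t p * Dq N A p"
    unfolding Dq_def pd_odd_scale gmult_scale_right
    by (subst Sum_any_right_distrib[OF finite_support_Dq]) (auto intro!: Sum_any.cong)
qed

lemma Dq_zero: "Dq (\<lambda>A p. 0) = (\<lambda>A p. 0)"
  using Dq_scale[of "\<lambda>p. 0"] by simp

abbreviation shift :: "'m \<times> nat \<Rightarrow> 'm \<times> nat" where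
  "shift g \<equiv> (fst g, Suc (snd g))"

lemma Dq_qvar: "Dq (qvar g) = qvar (shift g)"
proof (intro ext)
  fix A p
  have "(qvar (j, Suc k) \<star> pd_odd (j, k) (qvar g)) A p
      = (if (j, k) = g then qvar (shift g) A p else 0)" for j k
    by (cases "finite A") (auto simp: pd_odd_qvar gmult_embed gmult_zero_right, auto simp: qvar_def)
  then have "Dq (qvar g) A p = Sum_any (\<lambda>x. if x = g then qvar (shift g) A p else 0)"
    unfolding Dq_def by (intro Sum_any.cong) (auto split: prod.split)
  then show "Dq (qvar g) A p = qvar (shift g) A p" by simp
qed

text \<open>In the second term the sign of the odd derivative cancels the one from moving the
  shifted variable back behind \<open>qvar g\<close>.\<close>

lemma Dq_qvar_gmult_qvar:
  "Dq (qvar g \<star> qvar h) = (\<lambda>A p. (qvar (shift g) \<star> qvar h) A p + (qvar g \<star> qvar (shift h)) A p)"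
proof (intro ext)
  fix A p
  have "(qvar (j, Suc k) \<star> pd_odd (j, k) (qvar g \<star> qvar h)) A p
      = (if (j, k) = g then (qvar (shift g) \<star> qvar h) A p else 0)
      + (if (j, k) = h then (qvar g \<star> qvar (shift h)) A p else 0)" for j k
    unfolding pd_odd_qvar_gmult_qvar gmult_add_right
    by (auto simp: gmult_zero_right gmult_uminus_right qvar_anticommute[of g "(j, Suc k)"]
        qvar_anticommute[of "(j, k)" "(j, Suc k)"])
  then have "Dq (qvar g \<star> qvar h) A p
      = Sum_any (\<lambda>x. (if x = g then (qvar (shift g) \<star> qvar h) A p else 0)
      + (if x = h then (qvar g \<star> qvar (shift h)) A p else 0))"
    unfolding Dq_def by (intro Sum_any.cong) (auto split: prod.split)
  also have "\<dots> = (qvar (shift g) \<star> qvar h) A p + (qvar g \<star> qvar (shift h)) A p"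
    by (subst Sum_any.distrib) simp_all
  finally show "Dq (qvar g \<star> qvar h) A p
      = (qvar (shift g) \<star> qvar h) A p + (qvar g \<star> qvar (shift h)) A p" .
qed

text \<open>
  \<open>symbol G E K N B\<close> states that the function \<open>N\<close> on the covering and the \<open>\<C>\<close>-differential operator
  \<open>B\<close> on \<open>K\<close> have the same coefficients, in terms of the odd monomials \<open>G i\<close> and of the elementary
  operators \<open>E i\<close> respectively.
\<close>

inductive symbol ::
  "('i \<Rightarrow> 'm lfunc) \<Rightarrow> ('i \<Rightarrow> 'a \<Rightarrow> 'm func) \<Rightarrow> 'a set \<Rightarrow> 'm lfunc \<Rightarrow> ('a \<Rightarrow> 'm func) \<Rightarrow> bool"
  for G E K where
  zero: "symbol G E K (\<lambda>A p. 0) (\<lambda>a p. 0)"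
| monomial: "t \<in> FE \<Longrightarrow> symbol G E K (\<lambda>A p. t p * G i A p) (\<lambda>a p. t p * E i a p)"
| add: "symbol G E K N B \<Longrightarrow> symbol G E K N' B' \<Longrightarrow>
    symbol G E K (\<lambda>A p. N A p + N' A p) (\<lambda>a p. B a p + B' a p)"
| cong: "symbol G E K N B \<Longrightarrow> (\<And>a. a \<in> K \<Longrightarrow> B a = B' a) \<Longrightarrow> symbol G E K N B'"

lemma symbol_cong:
  assumes "symbol G E K N B" "\<And>A p. N A p = N' A p" "\<And>a p. a \<in> K \<Longrightarrow> B a p = B' a p"
  shows "symbol G E K N' B'"
proof -
  have "N = N'" using assms(2) by blast
  with assms show ?thesis by (blast intro: symbol.cong)
qed

lemma symbol_generator: "symbol G E K (G i) (E i)"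
  using symbol.monomial[OF FE_const[of 1]] by simp

lemma symbol_scale:
  assumes "symbol G E K N B" "s \<in> FE"
  shows "symbol G E K (\<lambda>A p. s p * N A p) (\<lambda>a p. s p * B a p)"
  using assms(1)
proof induction
  case zero
  show ?case using symbol.zero by simp
next
  case (monomial t i)
  show ?case
    by (rule symbol_cong[OF symbol.monomial[OF FE_mult[OF assms(2) monomial], of _ _ _ i]]) (simp_all add: ac_simps)
next
  case (add N B N' B')
  show ?case by (rule symbol_cong[OF symbol.add[OF add.IH]]) (simp_all add: algebra_simps)
next
  case (cong N B B')
  show ?case by (rule symbol_cong[OF cong.IH]) (simp_all add: cong.hyps)
qed

lemma symbol_sum:
  assumes "\<And>i. i \<in> I \<Longrightarrow> symbol G E K (N i) (B i)"
  shows "symbol G E K (\<lambda>A p. \<Sum>i\<in>I. N i A p) (\<lambda>a p. \<Sum>i\<in>I. B i a p)"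
  using assms
proof (induction I rule: infinite_finite_induct)
  case (insert i I)
  have "symbol G E K (\<lambda>A p. N i A p + (\<Sum>i\<in>I. N i A p)) (\<lambda>a p. B i a p + (\<Sum>i\<in>I. B i a p))"
    using insert by (intro symbol.add) auto
  with insert.hyps show ?case by simp
qed (simp_all add: symbol.zero)

text \<open>The point is that a single family \<open>T\<close> serves both sides. It need not be
  unique, as the monomials \<open>G i\<close> may be linearly dependent.\<close>

lemma symbol_coeffs:
  assumes "symbol G E K N B"
  shows "\<exists>T. finite {i. T i \<noteq> (\<lambda>p. 0)} \<and> (\<forall>i. T i \<in> FE)
    \<and> (\<forall>A p. N A p = Sum_any (\<lambda>i. T i p * G i A p))
    \<and> (\<forall>a\<in>K. \<forall>p. B a p = Sum_any (\<lambda>i. T i p * E i a p))"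
  using assms
proof induction
  case zero
  show ?case by (intro exI[of _ "\<lambda>i p. 0"]) (simp add: zero_in_FE)
next
  case (monomial t i)
  have *: "t p * z i = Sum_any (\<lambda>j. (if j = i then t else (\<lambda>p. 0)) p * z j)" for p and z :: "_ \<Rightarrow> real"
  proof -
    have "Sum_any (\<lambda>j. (if j = i then t else (\<lambda>p. 0)) p * z j)
        = Sum_any (\<lambda>j. if j = i then t p * z i else 0)"
      by (rule Sum_any.cong) auto
    then show ?thesis by simp
  qed
  have "finite {j. (if j = i then t else (\<lambda>p. 0)) \<noteq> (\<lambda>p. 0)}"
    by (rule finite_subset[of _ "{i}"]) auto
  with monomial show ?case
    by (intro exI[of _ "\<lambda>j. if j = i then t else (\<lambda>p. 0)"]) (auto simp: zero_in_FE intro: *)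
next
  case (add N B N' B')
  from add.IH(1) obtain T where T: "finite {i. T i \<noteq> (\<lambda>p. 0)}" "\<And>i. T i \<in> FE"
      "\<And>A p. N A p = Sum_any (\<lambda>i. T i p * G i A p)"
      "\<And>a p. a \<in> K \<Longrightarrow> B a p = Sum_any (\<lambda>i. T i p * E i a p)"
    by blast
  from add.IH(2) obtain T' where T': "finite {i. T' i \<noteq> (\<lambda>p. 0)}" "\<And>i. T' i \<in> FE"
      "\<And>A p. N' A p = Sum_any (\<lambda>i. T' i p * G i A p)"
      "\<And>a p. a \<in> K \<Longrightarrow> B' a p = Sum_any (\<lambda>i. T' i p * E i a p)"
    by blast
  have fin: "finite {i. T i p * z i \<noteq> 0}" "finite {i. T' i p * z i \<noteq> 0}" for p and z :: "_ \<Rightarrow> real"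
    by (rule finite_subset[OF _ T(1)], force, rule finite_subset[OF _ T'(1)], force)
  note distrib = Sum_any.distrib[OF fin, symmetric]
  have "finite {i. (\<lambda>p. T i p + T' i p) \<noteq> (\<lambda>p. 0)}"
    by (rule finite_subset[OF _ finite_UnI[OF T(1) T'(1)]]) auto
  then show ?case
    using T T' by (intro exI[of _ "\<lambda>i p. T i p + T' i p"])
      (simp add: FE_add distrib_right distrib)
next
  case (cong N B B')
  then show ?case by simp
qed

text \<open>The monomials have constant coefficients, so both derivatives of \<open>t\<close> times
  a generator obey the same Leibniz rule, and the generators alone have to be checked.\<close>

lemma symbol_Dx:
  fixes G :: "'i \<Rightarrow> 'm::{finite,linorder} lfunc"
  assumes "symbol G E K N B"
    and const: "\<And>i A p p'. G i A p = G i A p'"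
    and FE: "\<And>i a. a \<in> K \<Longrightarrow> E i a \<in> FE"
    and gen: "\<And>i. symbol G E K (Dq (G i)) (\<lambda>a. Dx (E i a))"
  shows "symbol G E K (Dx_cov N) (\<lambda>a. Dx (B a))"
proof -
  have const': "G i A = (\<lambda>p. G i A undefined)" for i A
    using const by blast
  have const_FE: "G i A \<in> FE" and const_Dx: "Dx (G i A) = (\<lambda>p. 0)" for i A
    by (subst const', rule FE_const, subst const', rule Dx_const)
  \<comment> \<open>Smoothness is carried through the induction because \<open>Dx\<close> is known
    to be additive only on \<open>FE\<close>.\<close>
  have "(\<forall>A. N A \<in> FE) \<and> (\<forall>a\<in>K. B a \<in> FE) \<and> symbol G E K (Dx_cov N) (\<lambda>a. Dx (B a))"
    using assms(1)
  proof induction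
    case zero
    show ?case by (auto simp: Dx_cov_eq Dx_const Dq_zero zero_in_FE intro: symbol.zero)
  next
    case (monomial t i)
    have "symbol G E K (Dx_cov (\<lambda>A p. t p * G i A p)) (\<lambda>a. Dx (\<lambda>p. t p * E i a p))"
      by (rule symbol_cong[OF symbol.add[OF symbol.monomial[OF FE_Dx[OF monomial]]
            symbol_scale[OF gen monomial]]])
        (simp_all add: Dx_cov_eq Dq_scale Dx_mult monomial FE const_FE const_Dx)
    with monomial show ?case by (auto intro: FE_mult const_FE FE)
  next
    case (add N B N' B')
    have "symbol G E K (\<lambda>A p. Dx_cov N A p + Dx_cov N' A p) (\<lambda>a p. Dx (B a) p + Dx (B' a) p)"
      using add by (intro symbol.add) blast+
    then have "symbol G E K (Dx_cov (\<lambda>A p. N A p + N' A p)) (\<lambda>a. Dx (\<lambda>p. B a p + B' a p))"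
      by (rule symbol_cong) (use add in \<open>simp_all add: Dx_cov_eq Dq_add Dx_add\<close>)
    with add show ?case by (auto intro: FE_add)
  next
    case (cong N B B')
    then show ?case by (auto intro: symbol_cong)
  qed
  then show ?thesis by blast
qed

section \<open>Linear and quadratic functions on the covering\<close>

definition gen_deriv :: "'m \<times> nat \<Rightarrow> ('m \<Rightarrow> 'm func) \<Rightarrow> 'm func" where
  "gen_deriv g \<phi> = (Dx ^^ snd g) (\<phi> (fst g))"

abbreviation lin_symbol :: "'m::linorder lfunc \<Rightarrow> (('m \<Rightarrow> 'm func) \<Rightarrow> 'm func) \<Rightarrow> bool" where
  "lin_symbol \<equiv> symbol qvar gen_deriv kappa"

text \<open>All ordered pairs of generators are allowed, so one function matches many operators:
  squares of generators vanish and reordering changes the sign.\<close>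

abbreviation quad_symbol ::
  "'m::linorder lfunc \<Rightarrow> (('m \<Rightarrow> 'm func) \<times> ('m \<Rightarrow> 'm func) \<Rightarrow> 'm func) \<Rightarrow> bool" where
  "quad_symbol \<equiv> symbol (\<lambda>(g, h). qvar g \<star> qvar h)
     (\<lambda>(g, h) (\<phi>, \<psi>) p. gen_deriv g \<phi> p * gen_deriv h \<psi> p) (kappa \<times> kappa)"

lemma FE_gen_deriv: "\<phi> \<in> kappa \<Longrightarrow> gen_deriv g \<phi> \<in> FE" for \<phi> :: "'m::finite \<Rightarrow> 'm func"
  by (simp add: gen_deriv_def FE_Dx_pow kappa_FE)

lemma Dx_gen_deriv: "Dx (gen_deriv g \<phi>) = gen_deriv (shift g) \<phi>"
  by (simp add: gen_deriv_def)

lemma lin_symbol_Dx: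
  fixes N :: "'m::{finite,linorder} lfunc"
  assumes "lin_symbol N B"
  shows "lin_symbol (Dx_cov N) (\<lambda>\<phi>. Dx (B \<phi>))"
proof (rule symbol_Dx[OF assms])
  fix g :: "'m \<times> nat"
  show "lin_symbol (Dq (qvar g)) (\<lambda>\<phi>. Dx (gen_deriv g \<phi>))"
    unfolding Dq_qvar Dx_gen_deriv by (rule symbol_generator)
qed (simp_all add: FE_gen_deriv qvar_def)

lemma quad_symbol_Dx:
  fixes N :: "'m::{finite,linorder} lfunc"
  assumes "quad_symbol N B"
  shows "quad_symbol (Dx_cov N) (\<lambda>a. Dx (B a))"
proof (rule symbol_Dx[OF assms])
  fix x :: "('m \<times> nat) \<times> ('m \<times> nat)"
  obtain g h where x: "x = (g, h)" by (cases x)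
  show "quad_symbol (Dq (case x of (g, h) \<Rightarrow> qvar g \<star> qvar h))
      (\<lambda>a. Dx ((case x of (g, h) \<Rightarrow> \<lambda>(\<phi>, \<psi>) p. gen_deriv g \<phi> p * gen_deriv h \<psi> p) a))"
    by (rule symbol_cong[OF symbol.add[OF symbol_generator[of _ _ _ "(shift g, h)"]
          symbol_generator[of _ _ _ "(g, shift h)"]]])
      (auto simp: x Dq_qvar_gmult_qvar Dx_mult FE_gen_deriv Dx_gen_deriv)
qed (auto simp: qvar_gmult_qvar intro: FE_mult FE_gen_deriv)

lemma lin_symbol_Dx_pow:
  fixes N :: "'m::{finite,linorder} lfunc"
  shows "lin_symbol N B \<Longrightarrow> lin_symbol ((Dx_cov ^^ k) N) (\<lambda>\<phi>. (Dx ^^ k) (B \<phi>))"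
  by (induction k) (auto intro: lin_symbol_Dx)

lemma quad_symbol_Dx_pow:
  fixes N :: "'m::{finite,linorder} lfunc"
  shows "quad_symbol N B \<Longrightarrow> quad_symbol ((Dx_cov ^^ k) N) (\<lambda>a. (Dx ^^ k) (B a))"
  by (induction k) (auto intro: quad_symbol_Dx)

text \<open>
  The product \<open>qvar g \<star> qvar h\<close> may be matched with a non-skew operator: \<open>N \<star> M\<close> then corresponds to
  the plain tensor product, and skew-symmetrization is postponed to \<open>quadratic_vector_eq\<close>.
\<close>

lemma quad_symbol_gmult:
  fixes N M :: "'m::{finite,linorder} lfunc"
  assumes "lin_symbol N B" "lin_symbol M C"
  shows "quad_symbol (N \<star> M) (\<lambda>(\<phi>, \<psi>) p. B \<phi> p * C \<psi> p)"
  using assms(1)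
proof induction
  case zero
  show ?case by (rule symbol_cong[OF symbol.zero]) (auto simp: gmult_zero_left)
next
  case (monomial t g)
  show ?case
    using assms(2)
  proof induction
    case zero
    show ?case by (rule symbol_cong[OF symbol.zero]) (auto simp: gmult_zero_right)
  next
    case (monomial s h)
    show ?case
      by (rule symbol_cong[OF symbol.monomial[OF FE_mult[OF \<open>t \<in> FE\<close> \<open>s \<in> FE\<close>], of _ _ _ "(g, h)"]])
        (auto simp: gmult_scale_left gmult_scale_right)
  next
    case (add M C M' C')
    show ?case
      by (rule symbol_cong[OF symbol.add[OF add.IH]]) (auto simp: gmult_add_right algebra_simps)
  next
    case (cong M C C')
    show ?case by (rule symbol_cong[OF cong.IH]) (auto simp: cong.hyps)
  qed
next
  case (add N B N' B')
  show ?case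
    by (rule symbol_cong[OF symbol.add[OF add.IH]]) (auto simp: gmult_add_left algebra_simps)
next
  case (cong N B B')
  show ?case by (rule symbol_cong[OF cong.IH]) (auto simp: cong.hyps)
qed

text \<open>Anticommutation rewrites the monomial of \<open>(g, h)\<close> as minus that of
  \<open>(h, g)\<close>. The old and the new operator have the same skew part.\<close>

lemma quad_symbol_swap:
  fixes N :: "'m::{finite,linorder} lfunc"
  assumes "quad_symbol N B"
  shows "quad_symbol N (\<lambda>(\<phi>, \<psi>) p. - B (\<psi>, \<phi>) p)"
  using assms
proof induction
  case zero
  show ?case by (rule symbol_cong[OF symbol.zero]) auto
next
  case (monomial t x)
  obtain g h where x: "x = (g, h)" by (cases x)
  show ?case
    by (rule symbol_cong[OF symbol.monomial[OF FE_uminus[OF monomial], of _ _ _ "(h, g)"]])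
      (auto simp: x qvar_anticommute[of g h])
next
  case (add N B N' B')
  show ?case by (rule symbol_cong[OF symbol.add[OF add.IH]]) auto
next
  case (cong N B B')
  show ?case by (rule symbol_cong[OF cong.IH]) (auto simp: cong.hyps)
qed

text \<open>Needed because multiplication by \<open>embed\<close> erases values at infinite
  sets.\<close>

lemma quad_symbol_infinite:
  assumes "quad_symbol N B" "infinite A"
  shows "N A p = 0"
  using assms(1)
proof induction
  case (monomial t x)
  then show ?case using assms(2) by (auto simp: qvar_gmult_qvar split: prod.split)
qed simp_all

section \<open>Odd vectors of differential operators and their derivatives\<close>

lemma odd_vector_eq:
  fixes R :: "'m::{finite,linorder} cdo"
  assumes "\<And>l j i. n \<le> i \<Longrightarrow> R l j i = (\<lambda>p. 0)"
  shows "odd_vector R = (\<lambda>l A p. \<Sum>j\<in>UNIV. \<Sum>i<n. R l j i p * qvar (j, i) A p)"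
  unfolding odd_vector_def by (intro ext Sum_any_jet) (simp add: assms)

text \<open>At a given \<open>A\<close> at most one term of the sum survives, so no finiteness of
  \<open>R\<close> is required and derivatives act coefficientwise.\<close>

lemma odd_vector_altdef:
  "odd_vector R l A = (if \<exists>g. A = {g} then (let g = the_elem A in R l (fst g) (snd g)) else (\<lambda>p. 0))"
proof
  fix p
  show "odd_vector R l A p
      = (if \<exists>g. A = {g} then (let g = the_elem A in R l (fst g) (snd g)) else (\<lambda>p. 0)) p"
  proof (cases "\<exists>g. A = {g}")
    case True
    then obtain g where g: "A = {g}" by blast
    have "odd_vector R l A p = Sum_any (\<lambda>x. if x = g then R l (fst g) (snd g) p else 0)"
      unfolding odd_vector_def by (intro Sum_any.cong) (auto simp: g qvar_def)
    with g show ?thesis by simp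
  next
    case False
    then have "A \<noteq> {g}" for g by blast
    with False show ?thesis by (simp only: odd_vector_def qvar_def case_prod_unfold) simp
  qed
qed

lemma lin_symbol_odd_vector:
  fixes R :: "'m::{finite,linorder} cdo"
  assumes "R \<in> cdo"
  shows "lin_symbol (odd_vector R l) (\<lambda>\<phi>. cdo_apply R \<phi> l)"
proof -
  obtain n where n: "\<And>l j i. n \<le> i \<Longrightarrow> R l j i = (\<lambda>p. 0)"
    using cdo_finite_order[OF assms] by blast
  have "lin_symbol (\<lambda>A p. \<Sum>j\<in>UNIV. \<Sum>i<n. R l j i p * qvar (j, i) A p)
      (\<lambda>\<phi> p. \<Sum>j\<in>UNIV. \<Sum>i<n. R l j i p * gen_deriv (j, i) \<phi> p)"
    by (intro symbol_sum symbol.monomial cdo_FE assms)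
  then show ?thesis
    by (rule symbol_cong) (simp_all add: odd_vector_eq[of n] cdo_apply_eq[of n] n gen_deriv_def)
qed

lemma pd_even_odd_vector:
  "pd_even c (odd_vector R l) = odd_vector (\<lambda>l j i. pd c (R l j i)) l"
  by (auto simp: pd_even_def odd_vector_altdef pd_const fun_eq_iff Let_def)

lemma pd_odd_odd_vector:
  fixes R :: "'m::linorder cdo"
  shows "pd_odd (j, k) (odd_vector R l) = embed (R l j k)"
proof (intro ext)
  fix A :: "('m \<times> nat) set" and p :: "'m jet"
  have "g \<notin> A \<Longrightarrow> (\<exists>h. insert g A = {h}) \<longleftrightarrow> A = {}" for g
    by auto
  then show "pd_odd (j, k) (odd_vector R l) A p = embed (R l j k) A p"
    by (auto simp: pd_odd_def odd_vector_altdef embed_def)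
qed

text \<open>Only the finitely many coefficients with \<open>i < n0\<close> can be nonzero; the
  maximum of their jet orders is a uniform bound.\<close>

lemma cdo_jet_order:
  fixes R :: "'m::finite cdo"
  assumes "R \<in> cdo"
  obtains n where "\<And>l j i a k. n \<le> k \<Longrightarrow> pd (CU a k) (R l j i) = (\<lambda>p. 0)"
proof -
  obtain n0 where n0: "\<And>l j i. n0 \<le> i \<Longrightarrow> R l j i = (\<lambda>p. 0)"
    using cdo_finite_order[OF assms] by blast
  have "\<exists>m. \<forall>a k. m \<le> k \<longrightarrow> pd (CU a k) (R l j i) = (\<lambda>p. 0)" for l j i
    using FE_finite_order[OF cdo_FE[OF assms]] by metis
  then obtain m where m: "\<And>l j i a k. m l j i \<le> k \<Longrightarrow> pd (CU a k) (R l j i) = (\<lambda>p. 0)"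
    by metis
  define M where "M = (\<lambda>(l, j, i). m l j i) ` (UNIV \<times> UNIV \<times> {..<n0})"
  have "finite M" by (simp add: M_def)
  have "pd (CU a k) (R l j i) = (\<lambda>p. 0)" if "Max (insert 0 M) \<le> k" for l j i a k
  proof (cases "i < n0")
    case True
    then have "m l j i \<in> M" by (force simp: M_def)
    then have "m l j i \<le> Max (insert 0 M)" using \<open>finite M\<close> by (intro Max_ge) auto
    with that m show ?thesis by simp
  qed (simp add: n0 pd_const)
  with that show thesis by blast
qed

text \<open>Regroups the double sum by the differentiated coordinate \<open>CU a k\<close> instead
  of by the power of \<open>Dx\<close>, the form in which \<open>beta_cov\<close> and
  \<open>Q_cov\<close> are written.\<close>

lemma cdo_apply_ev_cdo:
  fixes R :: "'m::finite cdo"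
  assumes "R \<in> cdo" and n: "\<And>l j i a k. n \<le> k \<Longrightarrow> pd (CU a k) (R l j i) = (\<lambda>p. 0)"
  shows "cdo_apply (ev_cdo \<theta> R) \<phi> l p = (\<Sum>a\<in>UNIV. \<Sum>k<n.
    (Dx ^^ k) (\<theta> a) p * cdo_apply (\<lambda>l j i. pd (CU a k) (R l j i)) \<phi> l p)"
proof -
  obtain r where r: "\<And>l j i. r \<le> i \<Longrightarrow> R l j i = (\<lambda>p. 0)"
    using cdo_finite_order[OF assms(1)] by blast
  then have zero: "ev_cdo \<theta> R l j i = (\<lambda>p. 0)" if "r \<le> i" for l j i
    using that by (simp add: ev_cdo_def Ev_const)
  have Ev: "Ev \<theta> (R l j i) = (\<lambda>p. \<Sum>a\<in>UNIV. \<Sum>k<n. (Dx ^^ k) (\<theta> a) p * pd (CU a k) (R l j i) p)"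
    for l j i by (rule Ev_eq) (rule n)
  have "cdo_apply (ev_cdo \<theta> R) \<phi> l p = (\<Sum>j\<in>UNIV. \<Sum>i<r. (\<Sum>a\<in>UNIV. \<Sum>k<n.
      (Dx ^^ k) (\<theta> a) p * pd (CU a k) (R l j i) p) * (Dx ^^ i) (\<phi> j) p)"
    by (simp add: cdo_apply_eq[of r "ev_cdo \<theta> R"] zero) (simp add: ev_cdo_def Ev)
  \<comment> \<open>Indices are packed into pairs so that one \<open>sum.swap\<close> exchanges both
    levels.\<close>
  also have "\<dots> = (\<Sum>x\<in>UNIV \<times> {..<r}. \<Sum>y\<in>UNIV \<times> {..<n}.
      (Dx ^^ snd y) (\<theta> (fst y)) p * (pd (CU (fst y) (snd y)) (R l (fst x) (snd x)) p
      * (Dx ^^ snd x) (\<phi> (fst x)) p))"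
    by (simp add: sum.cartesian_product' sum_distrib_right mult.assoc)
  also have "\<dots> = (\<Sum>y\<in>UNIV \<times> {..<n}. \<Sum>x\<in>UNIV \<times> {..<r}.
      (Dx ^^ snd y) (\<theta> (fst y)) p * (pd (CU (fst y) (snd y)) (R l (fst x) (snd x)) p
      * (Dx ^^ snd x) (\<phi> (fst x)) p))"
    by (rule sum.swap)
  also have "\<dots> = (\<Sum>a\<in>UNIV. \<Sum>k<n.
      (Dx ^^ k) (\<theta> a) p * (\<Sum>j\<in>UNIV. \<Sum>i<r. pd (CU a k) (R l j i) p * (Dx ^^ i) (\<phi> j) p))"
    by (simp add: sum.cartesian_product' sum_distrib_left)
  also have "\<dots> = (\<Sum>a\<in>UNIV. \<Sum>k<n.
      (Dx ^^ k) (\<theta> a) p * cdo_apply (\<lambda>l j i. pd (CU a k) (R l j i)) \<phi> l p)"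
    by (subst cdo_apply_eq[of r "\<lambda>l j i. pd _ (R l j i)"]) (simp_all add: r pd_const)
  finally show ?thesis .
qed

section \<open>Symbols of the constituents of the Jacobi bracket\<close>

lemma pd_cdo: "R \<in> cdo \<Longrightarrow> (\<lambda>l j i. pd c (R l j i)) \<in> cdo"
  by (rule cdo_map[where F = "pd c"]) (simp_all add: FE_pd pd_const)

lemma lin_symbol_pd_even_odd_vector:
  fixes R :: "'m::{finite,linorder} cdo"
  shows "R \<in> cdo \<Longrightarrow> lin_symbol (pd_even c (odd_vector R l))
    (\<lambda>\<phi>. cdo_apply (\<lambda>l j i. pd c (R l j i)) \<phi> l)"
  unfolding pd_even_odd_vector by (intro lin_symbol_odd_vector pd_cdo)

lemma pd_even_odd_vector_zero:
  assumes "\<And>j i. pd c (R l j i) = (\<lambda>p. 0)"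
  shows "pd_even c (odd_vector R l) = (\<lambda>A p. 0)"
  unfolding pd_even_odd_vector by (simp add: odd_vector_def assms case_prod_unfold)

text \<open>In \<open>beta_cov\<close> the variable standing for the direction of differentiation is
  the right factor. The swap makes it the first argument, at the cost of the minus sign.\<close>

lemma quad_symbol_beta_cov:
  fixes R :: "'m::{finite,linorder} cdo"
  assumes "R \<in> cdo"
  shows "quad_symbol (beta_cov (odd_vector R) l) (\<lambda>(\<phi>, \<psi>) p. - cdo_apply (ev_cdo \<phi> R) \<psi> l p)"
proof -
  obtain n where n: "\<And>l j i a k. n \<le> k \<Longrightarrow> pd (CU a k) (R l j i) = (\<lambda>p. 0)"
    using cdo_jet_order[OF assms] by blast
  \<comment> \<open>The nested abstractions reproduce the output of \<open>quad_symbol_swap\<close>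
    after \<open>quad_symbol_gmult\<close>, so that the rules unify.\<close>
  have "quad_symbol (\<lambda>A p. \<Sum>a\<in>UNIV. \<Sum>k<n. (pd_even (CU a k) (odd_vector R l) \<star> qvar (a, k)) A p)
    (\<lambda>x p. \<Sum>a\<in>UNIV. \<Sum>k<n. (\<lambda>(\<phi>, \<psi>) p. - ((\<lambda>(\<phi>, \<psi>) p. cdo_apply (\<lambda>l j i. pd (CU a k) (R l j i)) \<phi> l p
      * gen_deriv (a, k) \<psi> p) (\<psi>, \<phi>)) p) x p)"
    by (intro symbol_sum quad_symbol_swap quad_symbol_gmult lin_symbol_pd_even_odd_vector
        symbol_generator assms)
  then show ?thesis
  proof (rule symbol_cong)
    fix A p
    show "(\<Sum>a\<in>UNIV. \<Sum>k<n. (pd_even (CU a k) (odd_vector R l) \<star> qvar (a, k)) A p)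
        = beta_cov (odd_vector R) l A p"
      unfolding beta_cov_def
      by (rule Sum_any_jet[symmetric]) (simp add: pd_even_odd_vector_zero n gmult_zero_left)
  qed (auto simp: cdo_apply_ev_cdo[OF assms n] sum_negf gen_deriv_def mult.commute)
qed

text \<open>The even part gives the first term of \<open>fn_half\<close> by
  \<open>cdo_apply_ev_cdo\<close>. In the odd part the derivatives of the odd vector are the plain
  coefficients of \<open>S\<close>, so \<open>S\<close> is applied to \<open>beta_cov\<close>, whose
  symbol brings the minus sign.\<close>

lemma quad_symbol_Q_cov:
  fixes R S :: "'m::{finite,linorder} cdo"
  assumes "R \<in> cdo" "S \<in> cdo"
  shows "quad_symbol (Q_cov (odd_vector R) (odd_vector S l)) (\<lambda>(\<phi>, \<psi>). fn_half R S \<phi> \<psi> l)"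
proof -
  obtain n where n: "\<And>l j i a k. n \<le> k \<Longrightarrow> pd (CU a k) (S l j i) = (\<lambda>p. 0)"
    using cdo_jet_order[OF assms(2)] by blast
  obtain r where r: "\<And>l j i. r \<le> i \<Longrightarrow> S l j i = (\<lambda>p. 0)"
    using cdo_finite_order[OF assms(2)] by blast
  have 1: "quad_symbol
    (\<lambda>A p. \<Sum>j\<in>UNIV. \<Sum>k<n. ((Dx_cov ^^ k) (odd_vector R j) \<star> pd_even (CU j k) (odd_vector S l)) A p)
    (\<lambda>x p. \<Sum>j\<in>UNIV. \<Sum>k<n. (\<lambda>(\<phi>, \<psi>) p. (Dx ^^ k) (cdo_apply R \<phi> j) p
      * cdo_apply (\<lambda>l j' i. pd (CU j k) (S l j' i)) \<psi> l p) x p)"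
    by (intro symbol_sum quad_symbol_gmult lin_symbol_Dx_pow lin_symbol_pd_even_odd_vector
        lin_symbol_odd_vector assms)
  have 2: "quad_symbol
    (\<lambda>A p. \<Sum>j\<in>UNIV. \<Sum>k<r. S l j k p * (Dx_cov ^^ k) (beta_cov (odd_vector R) j) A p)
    (\<lambda>x p. \<Sum>j\<in>UNIV. \<Sum>k<r. S l j k p
      * (Dx ^^ k) ((\<lambda>(\<phi>, \<psi>) p. - cdo_apply (ev_cdo \<phi> R) \<psi> j p) x) p)"
    by (intro symbol_sum symbol_scale quad_symbol_Dx_pow quad_symbol_beta_cov cdo_FE assms)
  show ?thesis
  proof (rule symbol_cong[OF symbol.add[OF 1 2]])
    fix A p
    \<comment> \<open>At infinite \<open>A\<close> the product with \<open>embed\<close> is 0 by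
      convention, so the other side must vanish there as well.\<close>
    have inf: "infinite A \<Longrightarrow> (Dx_cov ^^ k) (beta_cov (odd_vector R) j) A p = 0" for j k
      using quad_symbol_infinite[OF quad_symbol_Dx_pow[OF quad_symbol_beta_cov[OF assms(1)]]] .
    have "Sum_any (\<lambda>(j, k). ((Dx_cov ^^ k) (odd_vector R j) \<star> pd_even (CU j k) (odd_vector S l)) A p)
      = (\<Sum>j\<in>UNIV. \<Sum>k<n. ((Dx_cov ^^ k) (odd_vector R j) \<star> pd_even (CU j k) (odd_vector S l)) A p)"
      by (rule Sum_any_jet) (simp add: pd_even_odd_vector_zero n gmult_zero_right)
    moreover have "Sum_any (\<lambda>(j, k). ((Dx_cov ^^ k) (beta_cov (odd_vector R) j)
        \<star> pd_odd (j, k) (odd_vector S l)) A p)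
      = (\<Sum>j\<in>UNIV. \<Sum>k<r. ((Dx_cov ^^ k) (beta_cov (odd_vector R) j)
        \<star> pd_odd (j, k) (odd_vector S l)) A p)"
      by (rule Sum_any_jet) (simp add: pd_odd_odd_vector gmult_embed r)
    moreover have "((Dx_cov ^^ k) (beta_cov (odd_vector R) j) \<star> pd_odd (j, k) (odd_vector S l)) A p
      = S l j k p * (Dx_cov ^^ k) (beta_cov (odd_vector R) j) A p" for j k
      by (simp add: pd_odd_odd_vector gmult_embed inf)
    ultimately show "(\<Sum>j\<in>UNIV. \<Sum>k<n. ((Dx_cov ^^ k) (odd_vector R j)
        \<star> pd_even (CU j k) (odd_vector S l)) A p)
      + (\<Sum>j\<in>UNIV. \<Sum>k<r. S l j k p * (Dx_cov ^^ k) (beta_cov (odd_vector R) j) A p)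
      = Q_cov (odd_vector R) (odd_vector S l) A p"
      by (simp add: Q_cov_def)
  next
    fix x :: "('m \<Rightarrow> 'm func) \<times> ('m \<Rightarrow> 'm func)" and p
    assume "x \<in> kappa \<times> kappa"
    then obtain \<phi> \<psi> where x: "x = (\<phi>, \<psi>)" "\<phi> \<in> kappa" "\<psi> \<in> kappa" by blast
    have "cdo_apply (ev_cdo \<phi> R) \<psi> j \<in> FE" for j
      by (intro kappa_FE kappa_cdo_apply ev_cdo_in_cdo assms x)
    then show "(\<Sum>j\<in>UNIV. \<Sum>k<n. (\<lambda>(\<phi>, \<psi>) p. (Dx ^^ k) (cdo_apply R \<phi> j) p
        * cdo_apply (\<lambda>l j' i. pd (CU j k) (S l j' i)) \<psi> l p) x p)
      + (\<Sum>j\<in>UNIV. \<Sum>k<r. S l j k p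
        * (Dx ^^ k) ((\<lambda>(\<phi>, \<psi>) p. - cdo_apply (ev_cdo \<phi> R) \<psi> j p) x) p)
      = (case x of (\<phi>, \<psi>) \<Rightarrow> fn_half R S \<phi> \<psi> l) p"
      by (simp add: x(1) fn_half_def cdo_apply_ev_cdo[OF assms(2) n] Dx_pow_uminus sum_negf
          cdo_apply_eq[of r S, OF r])
  qed
qed

text \<open>If \<open>T\<close> holds the common coefficients of \<open>N\<close> and
  \<open>B\<close>, the skew part of \<open>B\<close> has coefficients \<open>T l (g, h)\<close>
  minus \<open>T l (h, g)\<close>. Paired with anticommuting monomials, both halves give
  \<open>N\<close>, and the factor 1/2 compensates. Hence any symbol of \<open>N\<close> may be
  used, skew or not.\<close>

lemma quadratic_vector_eq:
  fixes \<Delta> :: "('m::{finite,linorder} \<Rightarrow> 'm func) \<Rightarrow> ('m \<Rightarrow> 'm func) \<Rightarrow> 'm \<Rightarrow> 'm func"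
  assumes N: "\<And>l. quad_symbol (N l) (\<lambda>(\<phi>, \<psi>). B \<phi> \<psi> l)"
    and skew: "\<And>\<phi> \<psi> l p. \<phi> \<in> kappa \<Longrightarrow> \<psi> \<in> kappa \<Longrightarrow> \<Delta> \<phi> \<psi> l p = B \<phi> \<psi> l p - B \<psi> \<phi> l p"
  shows "quadratic_vector \<Delta> = N"
proof -
  define P where "P l T \<longleftrightarrow> finite {x. T x \<noteq> (\<lambda>p. 0)} \<and> (\<forall>x. T x \<in> FE)
    \<and> (\<forall>A p. N l A p = Sum_any (\<lambda>x. T x p * (case x of (g, h) \<Rightarrow> qvar g \<star> qvar h) A p))
    \<and> (\<forall>a\<in>kappa \<times> kappa. \<forall>p. (case a of (\<phi>, \<psi>) \<Rightarrow> B \<phi> \<psi> l) p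
      = Sum_any (\<lambda>x. T x p * (case x of (g, h) \<Rightarrow> \<lambda>(\<phi>, \<psi>) p. gen_deriv g \<phi> p * gen_deriv h \<psi> p) a p))"
    for l T
  have "\<exists>T. P l T" for l
    unfolding P_def by (rule symbol_coeffs[OF N])
  then obtain T where "\<And>l. P l (T l)" by metis
  then have fin: "\<And>l. finite {x. T l x \<noteq> (\<lambda>p. 0)}" and FE: "\<And>l x. T l x \<in> FE"
    and T_N: "\<And>l A p. N l A p = Sum_any (\<lambda>x. T l x p * (case x of (g, h) \<Rightarrow> qvar g \<star> qvar h) A p)"
    and T_B: "\<And>l a p. a \<in> kappa \<times> kappa \<Longrightarrow> (case a of (\<phi>, \<psi>) \<Rightarrow> B \<phi> \<psi> l) p
      = Sum_any (\<lambda>x. T l x p * (case x of (g, h) \<Rightarrow> \<lambda>(\<phi>, \<psi>) p. gen_deriv g \<phi> p * gen_deriv h \<psi> p) a p)"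
    unfolding P_def by blast+
  \<comment> \<open>Projecting the support to both factors gives a square
    \<open>Y l \<times> Y l\<close>, which is invariant under exchanging \<open>g\<close> and
    \<open>h\<close>; this is what permits the uses of \<open>sum.swap\<close>.\<close>
  define Y where "Y l = fst ` {x. T l x \<noteq> (\<lambda>p. 0)} \<union> snd ` {x. T l x \<noteq> (\<lambda>p. 0)}" for l
  have Y: "finite (Y l)" for l
    using fin by (simp add: Y_def)
  have T0: "T l (g, h) = (\<lambda>p. 0)" if "(g, h) \<notin> Y l \<times> Y l" for l g h
    using that by (force simp: Y_def)
  have Sum_Y: "Sum_any (\<lambda>x. z x) = (\<Sum>g\<in>Y l. \<Sum>h\<in>Y l. z (g, h))"
    if "\<And>g h. (g, h) \<notin> Y l \<times> Y l \<Longrightarrow> z (g, h) = 0" for z :: "_ \<Rightarrow> real" and l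
  proof -
    have "Sum_any (\<lambda>x. z x) = (\<Sum>x\<in>Y l \<times> Y l. z x)"
      using that Y by (intro Sum_any.expand_superset) auto
    then show ?thesis by (simp add: sum.cartesian_product)
  qed
  have T_N': "N l A p = (\<Sum>g\<in>Y l. \<Sum>h\<in>Y l. T l (g, h) p * (qvar g \<star> qvar h) A p)" for l A p
    unfolding T_N by (subst Sum_Y[of l]) (simp_all add: T0 del: mem_Sigma_iff)
  have T_B': "B \<phi> \<psi> l p = (\<Sum>g\<in>Y l. \<Sum>h\<in>Y l. T l (g, h) p * (gen_deriv g \<phi> p * gen_deriv h \<psi> p))"
    if "\<phi> \<in> kappa" "\<psi> \<in> kappa" for \<phi> \<psi> l p
  proof -
    have "B \<phi> \<psi> l p = Sum_any (\<lambda>x. T l x p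
        * (case x of (g, h) \<Rightarrow> \<lambda>(\<phi>, \<psi>) p. gen_deriv g \<phi> p * gen_deriv h \<psi> p) (\<phi>, \<psi>) p)"
      using T_B[of "(\<phi>, \<psi>)" l p] that by simp
    then show ?thesis
      by (subst (asm) Sum_Y[of l]) (simp_all add: T0 del: mem_Sigma_iff)
  qed
  define c where "c l g h = (\<lambda>p. T l (g, h) p - T l (h, g) p)" for l g h
  have c0: "c l g h = (\<lambda>p. 0)" if "(g, h) \<notin> Y l \<times> Y l" for l g h
    using that T0[of g h l] T0[of h g l] by (auto simp: c_def)
  have "c \<in> bicdo"
  proof -
    have "{(g, h). c l g h \<noteq> (\<lambda>p. 0)} \<subseteq> Y l \<times> Y l" for l
      using c0 by blast
    then have "finite {(g, h). c l g h \<noteq> (\<lambda>p. 0)}" for l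
      using Y by (meson finite_SigmaI finite_subset)
    then show ?thesis
      by (simp add: bicdo_def c_def FE FE_diff)
  qed
  moreover have "\<Delta> \<phi> \<psi> l p = bicdo_apply c \<phi> \<psi> l p" if "\<phi> \<in> kappa" "\<psi> \<in> kappa" for \<phi> \<psi> l p
  proof -
    have "bicdo_apply c \<phi> \<psi> l p
        = Sum_any (\<lambda>x. c l (fst x) (snd x) p * gen_deriv (fst x) \<phi> p * gen_deriv (snd x) \<psi> p)"
      unfolding bicdo_apply_def gen_deriv_def by (intro Sum_any.cong) (auto split: prod.split)
    also have "\<dots> = (\<Sum>g\<in>Y l. \<Sum>h\<in>Y l. c l g h p * gen_deriv g \<phi> p * gen_deriv h \<psi> p)"
      by (subst Sum_Y[of l]) (simp_all add: c0 del: mem_Sigma_iff)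
    also have "\<dots> = B \<phi> \<psi> l p - (\<Sum>g\<in>Y l. \<Sum>h\<in>Y l. T l (h, g) p * (gen_deriv h \<psi> p * gen_deriv g \<phi> p))"
      by (simp add: T_B' that c_def sum_subtractf algebra_simps)
    also have "\<dots> = B \<phi> \<psi> l p - B \<psi> \<phi> l p"
      by (subst sum.swap) (simp add: T_B' that)
    finally show ?thesis using skew[OF that] by simp
  qed
  ultimately have "represents c \<Delta>"
    unfolding represents_def by blast
  then have "(THE c. represents c \<Delta>) = c"
    by (blast intro: represents_unique)
  then have "quadratic_vector \<Delta>
      = (\<lambda>l A p. 1 / 2 * Sum_any (\<lambda>x. c l (fst x) (snd x) p * (qvar (fst x) \<star> qvar (snd x)) A p))"
    by (simp add: quadratic_vector_def case_prod_unfold)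
  also have "\<dots> = N"
  proof (intro ext)
    fix l A p
    have "Sum_any (\<lambda>x. c l (fst x) (snd x) p * (qvar (fst x) \<star> qvar (snd x)) A p)
        = (\<Sum>g\<in>Y l. \<Sum>h\<in>Y l. c l g h p * (qvar g \<star> qvar h) A p)"
      by (subst Sum_Y[of l]) (simp_all add: c0 del: mem_Sigma_iff)
    also have "\<dots> = (\<Sum>g\<in>Y l. \<Sum>h\<in>Y l. T l (g, h) p * (qvar g \<star> qvar h) A p
        + T l (h, g) p * (qvar h \<star> qvar g) A p)"
    proof (intro sum.cong refl)
      fix g h
      show "c l g h p * (qvar g \<star> qvar h) A p
          = T l (g, h) p * (qvar g \<star> qvar h) A p + T l (h, g) p * (qvar h \<star> qvar g) A p"
        using qvar_anticommute[of h g A p] by (simp add: c_def algebra_simps)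
    qed
    also have "\<dots> = N l A p + (\<Sum>g\<in>Y l. \<Sum>h\<in>Y l. T l (h, g) p * (qvar h \<star> qvar g) A p)"
      by (simp add: T_N' sum.distrib)
    also have "\<dots> = N l A p + N l A p"
      by (subst sum.swap) (simp add: T_N')
    finally show "1 / 2 * Sum_any (\<lambda>x. c l (fst x) (snd x) p * (qvar (fst x) \<star> qvar (snd x)) A p)
        = N l A p" by simp
  qed
  finally show ?thesis .
qed

theorem theorem9:
  fixes f :: "'m::{finite,linorder} \<Rightarrow> 'm func" and R S :: "'m cdo"
  assumes "f \<in> kappa"
    and "R \<in> cdo" and "S \<in> cdo"
    and "is_shadow f (odd_vector R)" and "is_shadow f (odd_vector S)"
  shows "jacobi_cov (odd_vector R) (odd_vector S)
       = quadratic_vector (fn_bracket (cdo_apply R) (cdo_apply S))"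
proof -
  \<comment> \<open>The sum of the two halves is the non-skew operator whose skew part
    \<open>fn_bracket_eq\<close> identifies with the bracket.\<close>
  have "quad_symbol (jacobi_cov (odd_vector R) (odd_vector S) l)
      (\<lambda>(\<phi>, \<psi>). (\<lambda>l p. fn_half R S \<phi> \<psi> l p + fn_half S R \<phi> \<psi> l p) l)" for l
    by (rule symbol_cong[OF symbol.add[OF quad_symbol_Q_cov[OF assms(2,3)] quad_symbol_Q_cov[OF assms(3,2)]]])
      (auto simp: jacobi_cov_def)
  then show ?thesis
    by (rule quadratic_vector_eq[symmetric]) (rule fn_bracket_eq[OF assms(2,3)])
qed

end
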